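(* Let $0\le k<n$ and let $q$ be a critical value of $h\colon X_{n,k}\to\mathbb{R}$, $h(x)=\mathrm{Tr}(P^*P)$ for $x=\begin{bmatrix}T\\ P\end{bmatrix}$. The critical level $\Sigma_q$ is the total space of a fibre bundle with fibre $\mathrm{Sp}(k)$, structural group $\mathrm{Sp}(k-q)\times \mathrm{Sp}(q)$, and base the product of two Grassmannians $\mathrm{Gr}_{n-k,k-q}\times \mathrm{Gr}_{k,q}$.
   Context: $\mathbb{H}$ denotes the quaternions. $\mathrm{Sp}(n)$ is the Lie group of $n\times n$ quaternionic matrices $A$ with $A^*A=I_n$. $X_{n,k}$ is the Stiefel manifold of matrices $x\in\mathbb{H}^{n\times k}$ with $x^*x=I_k$, written in blocks $x=\begin{bmatrix}T\\ P\end{bmatrix}$ with $T\in\mathbb{H}^{(n-k)\times k}$, $P\in\mathbb{H}^{k\times k}$, so that $T^*T+P^*P=I_k$. $\Sigma_q$ denotes the set of critical points $x$ of $h$ with $h(x)=q$. The critical values of $h$ are the integers $q=0,\dots,k$ if $n\ge 2k$, and $q=2k-n,\dots,k$ if $n\le 2k$. $\mathrm{Gr}_{m,l}$ denotes the Grassmannian of $l$-dimensional quaternionic subspaces of $\mathbb{H}^m$. *)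

theory Defs
  imports
    "HOL-Analysis.Analysis"
    "HOL-Algebra.Group_Action"
    "Jordan_Normal_Form.Matrix"
begin

section \<open>Quaternions\<close>

datatype quat = Quat (qre: real) (qi: real) (qj: real) (qk: real)

lemma quat_eq_iff:
  "x = y \<longleftrightarrow> qre x = qre y \<and> qi x = qi y \<and> qj x = qj y \<and> qk x = qk y"
  by (auto intro: quat.expand)

instantiation quat :: ring_1
begin

definition "0 = Quat 0 0 0 0"
definition "1 = Quat 1 0 0 0"
definition "- x = Quat (- qre x) (- qi x) (- qj x) (- qk x)"
definition "x + y = Quat (qre x + qre y) (qi x + qi y) (qj x + qj y) (qk x + qk y)"
definition "x - y = Quat (qre x - qre y) (qi x - qi y) (qj x - qj y) (qk x - qk y)"
definition "x * y = Quat
  (qre x * qre y - qi x * qi y - qj x * qj y - qk x * qk y)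
  (qre x * qi y + qi x * qre y + qj x * qk y - qk x * qj y)
  (qre x * qj y - qi x * qk y + qj x * qre y + qk x * qi y)
  (qre x * qk y + qi x * qj y - qj x * qi y + qk x * qre y)"

instance
  by standard (simp_all add: quat_eq_iff zero_quat_def one_quat_def uminus_quat_def
      plus_quat_def minus_quat_def times_quat_def algebra_simps)

end

definition qcnj :: "quat \<Rightarrow> quat" where
  "qcnj x = Quat (qre x) (- qi x) (- qj x) (- qk x)"

instantiation quat :: real_vector
begin

definition "r *\<^sub>R x = Quat (r * qre x) (r * qi x) (r * qj x) (r * qk x)"

instance
  by standard (simp_all add: quat_eq_iff plus_quat_def scaleR_quat_def algebra_simps)

end

instantiation quat :: real_inner
begin

definition "inner x y = qre x * qre y + qi x * qi y + qj x * qj y + qk x * qk y"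
definition "norm (x :: quat) = sqrt (inner x x)"
definition "sgn (x :: quat) = x /\<^sub>R norm x"
definition "dist (x :: quat) y = norm (x - y)"
definition
  "(uniformity :: (quat \<times> quat) filter) = (INF e\<in>{0<..}. principal {(x, y). dist x y < e})"
definition
  "open (U :: quat set) \<longleftrightarrow> (\<forall>x\<in>U. eventually (\<lambda>(x', y). x' = x \<longrightarrow> y \<in> U) uniformity)"

instance
proof
  fix x y z :: quat and r s :: real
  show "inner x x = 0 \<longleftrightarrow> x = 0"
    by (simp add: inner_quat_def quat_eq_iff zero_quat_def add_nonneg_eq_0_iff)
qed (simp_all add: quat_eq_iff zero_quat_def plus_quat_def minus_quat_def uminus_quat_def
    scaleR_quat_def inner_quat_def norm_quat_def sgn_quat_def dist_quat_def
    uniformity_quat_def open_quat_def algebra_simps)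

end

instantiation quat :: real_normed_div_algebra
begin

definition "inverse x = qcnj x /\<^sub>R (norm x)\<^sup>2"
definition "x div y = x * inverse (y :: quat)"

instance
proof
  fix x y :: quat and r :: real
  have norm_sq: "(norm z)\<^sup>2 = (qre z)\<^sup>2 + (qi z)\<^sup>2 + (qj z)\<^sup>2 + (qk z)\<^sup>2" for z :: quat
    unfolding power2_norm_eq_inner inner_quat_def by (simp add: power2_eq_square)
  show "r *\<^sub>R x * y = r *\<^sub>R (x * y)" "x * r *\<^sub>R y = r *\<^sub>R (x * y)"
    by (simp_all add: quat_eq_iff times_quat_def scaleR_quat_def algebra_simps)
  have "(norm (x * y))\<^sup>2 = (norm x * norm y)\<^sup>2"
    unfolding power_mult_distrib norm_sq
    by (simp add: times_quat_def power2_eq_square algebra_simps)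
  then show "norm (x * y) = norm x * norm y"
    by simp
  show "inverse (0 :: quat) = 0"
    by (simp add: inverse_quat_def)
  show "x div y = x * inverse y"
    by (simp add: divide_quat_def)
  assume "x \<noteq> 0"
  then have n: "(norm x)\<^sup>2 \<noteq> 0"
    by simp
  have cm: "qcnj x * x = (norm x)\<^sup>2 *\<^sub>R 1" "x * qcnj x = (norm x)\<^sup>2 *\<^sub>R 1"
    unfolding norm_sq
    by (simp_all add: quat_eq_iff qcnj_def times_quat_def scaleR_quat_def one_quat_def
        power2_eq_square)
  have "(r *\<^sub>R a) * b = r *\<^sub>R (a * b)" "b * r *\<^sub>R a = r *\<^sub>R (b * a)" for r and a b :: quat
    by (simp_all add: quat_eq_iff times_quat_def scaleR_quat_def algebra_simps)
  then show "inverse x * x = 1" "x * inverse x = 1"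
    using n by (simp_all add: inverse_quat_def cm)
qed

end

section \<open>Quaternionic matrices\<close>

definition mat_adjoint :: "quat mat \<Rightarrow> quat mat" where
  "mat_adjoint A = mat (dim_col A) (dim_row A) (\<lambda>(i, j). qcnj (A $$ (j, i)))"

definition mat_trace :: "quat mat \<Rightarrow> quat" where
  "mat_trace A = (\<Sum>i<dim_row A. A $$ (i, i))"

text \<open>The Euclidean topology on \<open>r \<times> c\<close> matrices, i.e. the one of the space of entries.\<close>

definition mat_topology :: "nat \<Rightarrow> nat \<Rightarrow> quat mat topology" where
  "mat_topology r c =
     pullback_topology (carrier_mat r c) (\<lambda>A. restrict (($$) A) ({..<r} \<times> {..<c}))
       (product_topology (\<lambda>_. euclidean) ({..<r} \<times> {..<c}))"

definition stiefel :: "nat \<Rightarrow> nat \<Rightarrow> quat mat set" where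
  "stiefel n k = {x \<in> carrier_mat n k. mat_adjoint x * x = 1\<^sub>m k}"

definition stiefel_topology :: "nat \<Rightarrow> nat \<Rightarrow> quat mat topology" where
  "stiefel_topology n k = subtopology (mat_topology n k) (stiefel n k)"

definition Sp :: "nat \<Rightarrow> quat mat monoid" where
  "Sp n = \<lparr>carrier = {A \<in> carrier_mat n n. mat_adjoint A * A = 1\<^sub>m n},
           mult = (*), one = 1\<^sub>m n\<rparr>"

definition Sp_topology :: "nat \<Rightarrow> quat mat topology" where
  "Sp_topology n = subtopology (mat_topology n n) (carrier (Sp n))"

section \<open>Critical points of the height function\<close>

text \<open>The lower \<open>k \<times> k\<close> block \<open>P\<close> of an \<open>n \<times> k\<close> matrix, for \<open>k \<le> n\<close>.\<close>

definition lower_block :: "nat \<Rightarrow> nat \<Rightarrow> quat mat \<Rightarrow> quat mat" where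
  "lower_block n k x = mat k k (\<lambda>(i, j). x $$ (n - k + i, j))"

text \<open>The trace of \<open>P\<^sup>*P\<close> is a real quaternion, so that taking its real part only changes the type.\<close>

definition height :: "nat \<Rightarrow> nat \<Rightarrow> quat mat \<Rightarrow> real" where
  "height n k x = qre (mat_trace (mat_adjoint (lower_block n k x) * lower_block n k x))"

text \<open>
  The tangent vectors at \<open>x\<close> of the submanifold \<open>stiefel n k\<close> are the velocities at time \<open>0\<close> of the
  differentiable curves in \<open>stiefel n k\<close> through \<open>x\<close>; a point \<open>x\<close> is critical for \<open>h\<close> if
  the differential of \<open>h\<close> at \<open>x\<close> vanishes on all of them.
\<close>

definition stiefel_curve :: "nat \<Rightarrow> nat \<Rightarrow> (real \<Rightarrow> quat mat) \<Rightarrow> bool" where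
  "stiefel_curve n k \<gamma> \<longleftrightarrow>
     (\<forall>t. \<gamma> t \<in> stiefel n k) \<and>
     (\<forall>i<n. \<forall>j<k. \<forall>t. (\<lambda>s. \<gamma> s $$ (i, j)) differentiable (at t))"

definition critical_points :: "nat \<Rightarrow> nat \<Rightarrow> (quat mat \<Rightarrow> real) \<Rightarrow> quat mat set" where
  "critical_points n k h =
     {x \<in> stiefel n k. \<forall>\<gamma>. stiefel_curve n k \<gamma> \<and> \<gamma> 0 = x \<longrightarrow>
        ((\<lambda>t. h (\<gamma> t)) has_real_derivative 0) (at 0)}"

definition critical_values :: "nat \<Rightarrow> nat \<Rightarrow> (quat mat \<Rightarrow> real) \<Rightarrow> real set" where
  "critical_values n k h = h ` critical_points n k h"

definition critical_level :: "nat \<Rightarrow> nat \<Rightarrow> real \<Rightarrow> quat mat set" where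
  "critical_level n k q = {x \<in> critical_points n k (height n k). height n k x = q}"

definition critical_level_topology :: "nat \<Rightarrow> nat \<Rightarrow> real \<Rightarrow> quat mat topology" where
  "critical_level_topology n k q = subtopology (mat_topology n k) (critical_level n k q)"

section \<open>Grassmannians\<close>

text \<open>
  Matrices act on the left of column vectors, so the scalars act on the right; \<open>A *\<^sub>v c\<close> is
  the right linear combination of the columns of \<open>A\<close> with coefficients \<open>c\<close>.
\<close>

definition quat_subspace :: "nat \<Rightarrow> quat vec set \<Rightarrow> bool" where
  "quat_subspace m S \<longleftrightarrow>
     S \<subseteq> carrier_vec m \<and> 0\<^sub>v m \<in> S \<and>
     (\<forall>v\<in>S. \<forall>w\<in>S. v + w \<in> S) \<and>
     (\<forall>v\<in>S. \<forall>a. map_vec (\<lambda>z. z * a) v \<in> S)"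

definition column_space :: "quat mat \<Rightarrow> quat vec set" where
  "column_space A = (\<lambda>c. A *\<^sub>v c) ` carrier_vec (dim_col A)"

definition independent_columns :: "quat mat \<Rightarrow> bool" where
  "independent_columns A \<longleftrightarrow>
     (\<forall>c \<in> carrier_vec (dim_col A). A *\<^sub>v c = 0\<^sub>v (dim_row A) \<longrightarrow> c = 0\<^sub>v (dim_col A))"

text \<open>A subspace is \<open>l\<close>-dimensional if it has a basis of \<open>l\<close> vectors, the columns of \<open>A\<close> below.\<close>

definition grassmannian :: "nat \<Rightarrow> nat \<Rightarrow> quat vec set set" where
  "grassmannian m l =
     {S. quat_subspace m S \<and>
         (\<exists>A \<in> carrier_mat m l. independent_columns A \<and> column_space A = S)}"

text \<open>
  The quotient topology with respect to the map sending an orthonormal \<open>l\<close>-frame to its span.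
\<close>

definition grassmannian_topology :: "nat \<Rightarrow> nat \<Rightarrow> quat vec set topology" where
  "grassmannian_topology m l =
     topology (\<lambda>U. U \<subseteq> grassmannian m l \<and>
       openin (stiefel_topology m l) {x \<in> stiefel m l. column_space x \<in> U})"

lemma openin_grassmannian_topology:
  "openin (grassmannian_topology m l) U \<longleftrightarrow>
     U \<subseteq> grassmannian m l \<and>
     openin (stiefel_topology m l) {x \<in> stiefel m l. column_space x \<in> U}"
proof -
  let ?P = "\<lambda>U. {x \<in> stiefel m l. column_space x \<in> U}"
  have Int: "?P (U \<inter> V) = ?P U \<inter> ?P V" for U V
    by auto
  have Un: "?P (\<Union>K) = \<Union>(?P ` K)" for K
    by auto
  have "istopology (\<lambda>U. U \<subseteq> grassmannian m l \<and> openin (stiefel_topology m l) (?P U))"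
    unfolding istopology_def Int Un by auto
  then show ?thesis
    by (simp add: grassmannian_topology_def topology_inverse')
qed

section \<open>Fibre bundles with structure group\<close>

definition topological_group :: "('g, 'm) monoid_scheme \<Rightarrow> 'g topology \<Rightarrow> bool" where
  "topological_group G T \<longleftrightarrow>
     group G \<and> topspace T = carrier G \<and>
     continuous_map (prod_topology T T) T (\<lambda>(a, b). a \<otimes>\<^bsub>G\<^esub> b) \<and>
     continuous_map T T (\<lambda>a. inv\<^bsub>G\<^esub> a)"

text \<open>
  Fibre bundles in the sense of Steenrod: the projection \<open>p\<close> is locally trivial with fibre \<open>F\<close>,
  and on overlaps the trivialisations differ by a continuous map into the topological group \<open>G\<close>,
  which acts continuously and effectively on \<open>F\<close> through \<open>act\<close>.
\<close>

definition fibre_bundle ::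
  "'e topology \<Rightarrow> 'b topology \<Rightarrow> ('e \<Rightarrow> 'b) \<Rightarrow> 'f topology \<Rightarrow>
   ('g, 'm) monoid_scheme \<Rightarrow> 'g topology \<Rightarrow> ('g \<Rightarrow> 'f \<Rightarrow> 'f) \<Rightarrow> bool" where
  "fibre_bundle E B p F G T act \<longleftrightarrow>
     topological_group G T \<and>
     faithful_action G (topspace F) act \<and>
     continuous_map (prod_topology T F) F (\<lambda>(g, y). act g y) \<and>
     continuous_map E B p \<and>
     (\<exists>\<A> :: ('b set \<times> ('b \<times> 'f \<Rightarrow> 'e)) set.
        \<Union>(fst ` \<A>) = topspace B \<and>
        (\<forall>(U, \<phi>) \<in> \<A>.
           openin B U \<and>
           homeomorphic_map (prod_topology (subtopology B U) F)
             (subtopology E {e \<in> topspace E. p e \<in> U}) \<phi> \<and>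
           (\<forall>b\<in>U. \<forall>y\<in>topspace F. p (\<phi> (b, y)) = b)) \<and>
        (\<forall>(U, \<phi>) \<in> \<A>. \<forall>(V, \<psi>) \<in> \<A>.
           \<exists>g. continuous_map (subtopology B (U \<inter> V)) T g \<and>
             (\<forall>b \<in> U \<inter> V. \<forall>y\<in>topspace F. \<psi> (b, y) = \<phi> (b, act (g b) y))))"

text \<open>
  \<open>Sp(l) \<times> Sp(q)\<close> acts on \<open>Sp(l + q)\<close> by left translations, as the subgroup of block diagonal
  matrices.  The restriction is there because HOL-Algebra's actions consist of extensional functions.
\<close>

definition block_translation :: "nat \<Rightarrow> quat mat \<times> quat mat \<Rightarrow> quat mat \<Rightarrow> quat mat" where
  "block_translation k = (\<lambda>(a, b). \<lambda>C \<in> carrier (Sp k). diag_block_mat [a, b] * C)"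

end

theory Submission
  imports Defs
begin

text \<open>
  Write a point of the Stiefel manifold as \<open>T\<close> on top of \<open>P\<close>.  It is critical for the height exactly
  if \<open>T P\<^sup>* = 0\<close>: rotating a row of \<open>T\<close> against a row of \<open>P\<close> changes the height at a rate given by
  an entry of \<open>T P\<^sup>*\<close>, and if \<open>T P\<^sup>* = 0\<close>, then along every curve the height is a constant plus and
  minus sums of squares that vanish at the point (\<open>critical_imp_orthogonal_blocks\<close>,
  \<open>orthogonal_blocks_imp_critical\<close>).  In that case \<open>T\<close> and \<open>P\<close> are partial isometries whose
  initial spaces are orthogonal complements of each other, and the height is the rank of \<open>P\<close>.

  Let \<open>q\<close> be this rank, and let the columns of \<open>Y\<close> and \<open>Z\<close> be orthonormal bases of the column spaces
  of \<open>T\<close> and \<open>P\<close>, which have dimensions \<open>k - q\<close> and \<open>q\<close>.  With \<open>D = diag(Y, Z)\<close>, the point is \<open>x = D C\<close> for a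
  unique \<open>C\<close>, namely \<open>C = D\<^sup>* x\<close>, and \<open>C\<close> is in \<open>Sp(k)\<close>; conversely all such products are critical of
  level \<open>q\<close>.  Another choice of bases \<open>Y a\<close>, \<open>Z b\<close> replaces \<open>C\<close> by \<open>diag(a, b)\<^sup>* C\<close>.  So the level is
  the bundle associated with the product of the principal bundles of orthonormal frames over the two
  Grassmannians and the action of \<open>Sp(k - q) \<times> Sp(q)\<close> on \<open>Sp(k)\<close>; its projection takes \<open>x\<close> to the two
  column spaces, and every pair of local sections of the frame bundles gives a chart.

  Two devices replace linear algebra over a skew field and the manifold structure of the Grassmannian.
  First, the real part of the trace satisfies \<open>tr(AB) = tr(BA)\<close>, and a Hermitian idempotent has
  nonnegative trace, which vanishes only for the zero matrix.  Hence two Hermitian idempotents with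
  \<open>E F = F\<close> and equal traces coincide (\<open>proj_eqI\<close>).  These facts about traces give \<open>A A\<^sup>* = 1\<close> in
  \<open>Sp(n)\<close>, the bound on the length of an orthonormal frame, the invariance of dimension, and the rank
  of \<open>T\<close> and \<open>P\<close>.  Second, a subspace is identified with the orthogonal projection onto it.  One
  Gram-Schmidt step depends continuously on its input as long as it does not divide by zero, so the
  Gram-Schmidt process applied to \<open>E s\<close>, for a fixed frame \<open>s\<close>, produces frames of the image
  of \<open>E\<close> that vary continuously with the projection \<open>E\<close> (\<open>local_frames_of_projections\<close>).  This gives
  the local sections, and it also shows that a map into the Grassmannian is continuous as soon as the
  corresponding map into the projections is (\<open>continuous_map_grassmannianI\<close>).
\<close>

(* The symbol $ is kept for the components of vectors of type vec in the sense of Matrix. *)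
unbundle no vec_syntax

section \<open>Quaternions\<close>


lemmas quat_defs = quat_eq_iff zero_quat_def one_quat_def plus_quat_def minus_quat_def
  uminus_quat_def times_quat_def scaleR_quat_def qcnj_def

lemma qcnj_simps [simp]:
  "qcnj (x * y) = qcnj y * qcnj x" "qcnj (x + y) = qcnj x + qcnj y" "qcnj (x - y) = qcnj x - qcnj y"
  "qcnj (qcnj x) = x" "qcnj 0 = 0" "qcnj 1 = 1" "qcnj (r *\<^sub>R x) = r *\<^sub>R qcnj x"
  by (simp_all add: quat_defs algebra_simps)

lemma qcnj_sum: "qcnj (sum f A) = (\<Sum>a\<in>A. qcnj (f a))"
  by (induction A rule: infinite_finite_induct) auto

lemma qre_simps [simp]: "qre 0 = 0" "qre 1 = 1" "qre (x + y) = qre x + qre y" "qre (x - y) = qre x - qre y"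
  "qre (r *\<^sub>R x) = r * qre x"
  by (simp_all add: quat_defs)

lemma qre_sum: "qre (sum f A) = (\<Sum>a\<in>A. qre (f a))"
  by (induction A rule: infinite_finite_induct) auto

lemma qre_mult_commute: "qre (x * y) = qre (y * x)"
  by (simp add: quat_defs algebra_simps)

lemma qcnj_mult_self: "qcnj z * z = (norm z)\<^sup>2 *\<^sub>R 1"
  unfolding power2_norm_eq_inner inner_quat_def by (simp add: quat_defs)

lemma norm_qcnj [simp]: "norm (qcnj z) = norm z"
  by (simp add: norm_quat_def inner_quat_def qcnj_def)

section \<open>Adjoints and traces\<close>

lemma dim_mat_adjoint [simp]: "dim_row (mat_adjoint A) = dim_col A" "dim_col (mat_adjoint A) = dim_row A"
  by (simp_all add: mat_adjoint_def)

lemma index_mat_adjoint [simp]: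
  "i < dim_col A \<Longrightarrow> j < dim_row A \<Longrightarrow> mat_adjoint A $$ (i, j) = qcnj (A $$ (j, i))"
  by (simp add: mat_adjoint_def)

lemma mat_adjoint_carrier [simp]: "mat_adjoint A \<in> carrier_mat c r \<longleftrightarrow> A \<in> carrier_mat r c"
  unfolding carrier_mat_def mem_Collect_eq by auto

lemma mat_adjoint_adjoint [simp]: "mat_adjoint (mat_adjoint A) = A"
  by (rule eq_matI) auto

lemma mat_adjoint_one [simp]: "mat_adjoint (1\<^sub>m r) = 1\<^sub>m r"
  by (rule eq_matI) auto

lemma mat_adjoint_minus: "A \<in> carrier_mat r c \<Longrightarrow> B \<in> carrier_mat r c \<Longrightarrow>
   mat_adjoint (A - B) = mat_adjoint A - mat_adjoint B"
  by (rule eq_matI) auto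

lemma mult_index: "i < dim_row A \<Longrightarrow> j < dim_col B \<Longrightarrow> dim_col A = dim_row B \<Longrightarrow>
  (A * B) $$ (i, j) = (\<Sum>l<dim_row B. A $$ (i, l) * B $$ (l, j))"
  by (simp add: scalar_prod_def atLeast0LessThan)

lemma mat_adjoint_mult: "dim_col A = dim_row B \<Longrightarrow> mat_adjoint (A * B) = mat_adjoint B * mat_adjoint A"
  by (rule eq_matI) (auto simp: mult_index qcnj_sum simp del: index_mult_mat(1))

text \<open>
  A form of associativity whose premises mention only dimensions, so that the simplifier can
  discharge them without guessing the sizes of intermediate matrices.
\<close>
lemma mat_assoc:
  fixes A B C :: "quat mat"
  shows "dim_col A = dim_row B \<Longrightarrow> dim_col B = dim_row C \<Longrightarrow> (A * B) * C = A * (B * C)"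
  by (rule assoc_mult_mat[of _ "dim_row A" "dim_col A" _ "dim_col B" _ "dim_col C"]) auto

lemma mat_eq_vecI:
  fixes A B :: "quat mat"
  assumes "A \<in> carrier_mat r c" "B \<in> carrier_mat r c"
    and "\<And>v. v \<in> carrier_vec c \<Longrightarrow> A *\<^sub>v v = B *\<^sub>v v"
  shows "A = B"
proof (rule eq_matI)
  fix i j assume ij: "i < dim_row B" "j < dim_col B"
  have *: "(M *\<^sub>v unit_vec c j) $ i = M $$ (i, j)" if "M \<in> carrier_mat r c" for M :: "quat mat"
  proof -
    have "(M *\<^sub>v unit_vec c j) $ i = (\<Sum>l = 0..<c. M $$ (i, l) * (if l = j then 1 else 0))"
      using that ij assms by (auto simp: scalar_prod_def intro!: sum.cong)
    also have "\<dots> = (\<Sum>l = 0..<c. if l = j then M $$ (i, j) else 0)"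
      by (intro sum.cong) auto
    finally show ?thesis using ij assms by simp
  qed
  show "A $$ (i, j) = B $$ (i, j)"
    using *[OF assms(1)] *[OF assms(2)] assms(3)[of "unit_vec c j"] by simp
qed (use assms in auto)

text \<open>
  The full trace of quaternionic matrices is not invariant under cyclic permutations, but its
  real part is.
\<close>
definition rtr :: "quat mat \<Rightarrow> real" where "rtr A = qre (mat_trace A)"

lemma rtr_eq: "rtr A = (\<Sum>i<dim_row A. qre (A $$ (i, i)))"
  by (simp add: rtr_def mat_trace_def qre_sum)

lemma rtr_minus: "A \<in> carrier_mat m m \<Longrightarrow> B \<in> carrier_mat m m \<Longrightarrow> rtr (A - B) = rtr A - rtr B"
  by (simp add: rtr_eq sum_subtractf)

lemma rtr_one [simp]: "rtr (1\<^sub>m m) = real m"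
  by (simp add: rtr_eq)

lemma rtr_mult_commute:
  assumes "A \<in> carrier_mat r c" "B \<in> carrier_mat c r"
  shows "rtr (A * B) = rtr (B * A)"
proof -
  have "rtr (A * B) = (\<Sum>i<r. \<Sum>l<c. qre (A $$ (i, l) * B $$ (l, i)))"
    using assms by (simp add: rtr_eq mult_index qre_sum del: index_mult_mat(1))
  also have "\<dots> = (\<Sum>l<c. \<Sum>i<r. qre (B $$ (l, i) * A $$ (i, l)))"
    by (subst sum.swap) (simp add: qre_mult_commute)
  also have "\<dots> = rtr (B * A)"
    using assms by (simp add: rtr_eq mult_index qre_sum del: index_mult_mat(1))
  finally show ?thesis .
qed

lemma rtr_adjoint_mult_self:
  assumes "A \<in> carrier_mat r c"
  shows "rtr (mat_adjoint A * A) = (\<Sum>j<c. \<Sum>i<r. (norm (A $$ (i, j)))\<^sup>2)"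
  using assms
  by (simp add: rtr_eq mult_index qre_sum qcnj_mult_self del: index_mult_mat(1))

lemma rtr_adjoint_mult_self_nonneg: "0 \<le> rtr (mat_adjoint A * A)"
  by (simp add: rtr_adjoint_mult_self[of A "dim_row A" "dim_col A"] sum_nonneg)

lemma rtr_adjoint_mult_self_eq_0:
  assumes "A \<in> carrier_mat r c" "rtr (mat_adjoint A * A) = 0"
  shows "A = 0\<^sub>m r c"
proof (rule eq_matI)
  fix i j assume "i < dim_row (0\<^sub>m r c :: quat mat)" "j < dim_col (0\<^sub>m r c :: quat mat)"
  then show "A $$ (i, j) = 0\<^sub>m r c $$ (i, j)"
    using assms(2) unfolding rtr_adjoint_mult_self[OF assms(1)]
    by (simp add: sum_nonneg_eq_0_iff sum_nonneg)
qed (use assms in auto)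

section \<open>Orthogonal projections\<close>

definition is_proj :: "nat \<Rightarrow> quat mat \<Rightarrow> bool" where
  "is_proj m E \<longleftrightarrow> E \<in> carrier_mat m m \<and> mat_adjoint E = E \<and> E * E = E"

lemma proj_rtr_nonneg: "is_proj m E \<Longrightarrow> 0 \<le> rtr E"
  using rtr_adjoint_mult_self_nonneg[of E] by (simp add: is_proj_def)

text \<open>
  Taking adjoints in \<open>E F = F\<close> gives \<open>F E = F\<close>, so the mixed terms of the square of \<open>E - F\<close> add up to
  \<open>- 2 F\<close>.
\<close>
lemma proj_diff:
  assumes "is_proj m E" "is_proj m F" "E * F = F"
  shows "is_proj m (E - F)"
proof -
  have [simp]: "dim_row E = m" "dim_col E = m" "dim_row F = m" "dim_col F = m"
    using assms by (auto simp: is_proj_def)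
  have "F * E = mat_adjoint (E * F)"
    using assms(1,2) by (simp add: mat_adjoint_mult is_proj_def)
  then have FE: "F * E = F"
    using assms by (simp add: is_proj_def)
  have c: "E \<in> carrier_mat m m" "F \<in> carrier_mat m m" by auto
  have "(E - F) * (E - F) = E * (E - F) - F * (E - F)"
    by (rule minus_mult_distrib_mat[OF c minus_carrier_mat[OF c(2)]])
  also have "E * (E - F) = E * E - E * F"
    by (rule mult_minus_distrib_mat[OF c(1) c])
  also have "F * (E - F) = F * E - F * F"
    by (rule mult_minus_distrib_mat[OF c(2) c])
  finally have "(E - F) * (E - F) = (E - F) - (F - F)"
    using assms FE by (simp add: is_proj_def)
  also have "\<dots> = E - F"
    by (rule eq_matI) auto
  finally have "(E - F) * (E - F) = E - F" .
  moreover have "mat_adjoint (E - F) = E - F"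
    using assms(1,2) unfolding mat_adjoint_minus[OF c] is_proj_def by simp
  ultimately show ?thesis
    using minus_carrier_mat[OF c(2)] by (simp add: is_proj_def)
qed

text \<open>
  The difference is a Hermitian idempotent of trace zero, and the trace of a Hermitian idempotent
  is the sum of the squared norms of its entries.
\<close>
lemma proj_eqI:
  assumes "is_proj m E" "is_proj m F" "E * F = F" "rtr E = rtr F"
  shows "E = F"
proof -
  have c: "E \<in> carrier_mat m m" "F \<in> carrier_mat m m"
    using assms by (auto simp: is_proj_def)
  have "is_proj m (E - F)"
    by (rule proj_diff[OF assms(1-3)])
  then have z: "E - F = 0\<^sub>m m m"
    using c assms(4) by (intro rtr_adjoint_mult_self_eq_0) (auto simp: is_proj_def rtr_minus)
  show ?thesis
  proof (rule eq_matI)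
    fix i j assume "i < dim_row F" "j < dim_col F"
    then show "E $$ (i, j) = F $$ (i, j)"
      using c arg_cong[OF z, of "\<lambda>A. A $$ (i, j)"] by simp
  qed (use c in auto)
qed

lemma proj_one: "is_proj m (1\<^sub>m m)"
  by (simp add: is_proj_def)

text \<open>
  For a partial isometry \<open>T\<close>, the matrix \<open>T T\<^sup>*\<close> is the orthogonal projection onto its column
  space.
\<close>
lemma partial_isometry_proj:
  assumes "T \<in> carrier_mat m c" "T * (mat_adjoint T * T) = T"
  shows "is_proj m (T * mat_adjoint T)"
proof -
  have d: "dim_row T = m" "dim_col T = c" using assms(1) by auto
  have "T * mat_adjoint T * (T * mat_adjoint T) = T * (mat_adjoint T * T) * mat_adjoint T"
    using d by (simp add: mat_assoc)
  moreover have "mat_adjoint (T * mat_adjoint T) = T * mat_adjoint T"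
    using d by (simp add: mat_adjoint_mult)
  moreover have "T * mat_adjoint T \<in> carrier_mat m m"
    using d by auto
  ultimately show ?thesis
    unfolding is_proj_def assms(2) by blast
qed

lemma stiefelD:
  assumes "Y \<in> stiefel m l"
  shows "Y \<in> carrier_mat m l" "dim_row Y = m" "dim_col Y = l" "mat_adjoint Y * Y = 1\<^sub>m l"
    "Y * (mat_adjoint Y * Y) = Y" "is_proj m (Y * mat_adjoint Y)"
    "rtr (Y * mat_adjoint Y) = real l"
proof -
  show c: "Y \<in> carrier_mat m l" and o: "mat_adjoint Y * Y = 1\<^sub>m l"
    using assms by (simp_all add: stiefel_def)
  show d: "dim_row Y = m" "dim_col Y = l"
    using c by simp_all
  show i: "Y * (mat_adjoint Y * Y) = Y"
    unfolding o using d by simp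
  show "is_proj m (Y * mat_adjoint Y)"
    by (rule partial_isometry_proj[OF c i])
  have "rtr (Y * mat_adjoint Y) = rtr (mat_adjoint Y * Y)"
    using c by (intro rtr_mult_commute) auto
  then show "rtr (Y * mat_adjoint Y) = real l"
    by (simp add: o)
qed

text \<open>
  The projection \<open>1 - Y Y\<^sup>*\<close> onto the orthogonal complement of a frame has trace \<open>m - l\<close>.
\<close>
lemma stiefel_le: 
  assumes "Y \<in> stiefel m l"
  shows "l \<le> m"
proof -
  have "is_proj m (1\<^sub>m m - Y * mat_adjoint Y)"
    by (rule proj_diff[OF proj_one stiefelD(6)[OF assms]]) (use stiefelD[OF assms] in auto)
  from proj_rtr_nonneg[OF this] show ?thesis
    using stiefelD[OF assms] by (simp add: rtr_minus[of _ m])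
qed

lemma carrier_Sp: "carrier (Sp n) = stiefel n n"
  by (auto simp: Sp_def stiefel_def)

text \<open>
  A one-sided inverse is two-sided, by comparing the traces of the projections \<open>1\<close>
  and \<open>A A\<^sup>*\<close>.
\<close>
lemma Sp_mult_adjoint:
  assumes "A \<in> stiefel n n"
  shows "A * mat_adjoint A = 1\<^sub>m n"
  using stiefelD[OF assms] by (intro proj_eqI[OF proj_one, symmetric]) auto

section \<open>Column spaces\<close>

lemma column_space_mult_subset:
  assumes "dim_col A = dim_row R"
  shows "column_space (A * R) \<subseteq> column_space A"
proof -
  have "A * R *\<^sub>v c = A *\<^sub>v (R *\<^sub>v c)" "R *\<^sub>v c \<in> carrier_vec (dim_col A)"
    if "c \<in> carrier_vec (dim_col R)" for c
    using that assms by (auto intro: assoc_mult_mat_vec mult_mat_vec_carrier carrier_matI)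
  then show ?thesis
    by (auto simp: column_space_def)
qed

lemma column_space_subset_proj:
  assumes E: "E \<in> carrier_mat m m" "E * E = E" and X: "X \<in> carrier_mat m c"
    and sub: "column_space X \<subseteq> column_space E"
  shows "E * X = X"
proof (rule mat_eq_vecI)
  fix v :: "quat vec" assume v: "v \<in> carrier_vec c"
  then have "X *\<^sub>v v \<in> column_space E"
    using sub X by (auto simp: column_space_def)
  then obtain w where w: "w \<in> carrier_vec m" "X *\<^sub>v v = E *\<^sub>v w"
    using E by (auto simp: column_space_def)
  have "E * X *\<^sub>v v = E *\<^sub>v (X *\<^sub>v v)"
    by (rule assoc_mult_mat_vec[OF E(1) X v])
  also have "\<dots> = E * E *\<^sub>v w"
    unfolding w(2) by (rule assoc_mult_mat_vec[OF E(1) E(1) w(1), symmetric])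
  finally show "E * X *\<^sub>v v = X *\<^sub>v v"
    unfolding E(2) w(2) .
qed (use E X in auto)

lemma proj_eq_column_space:
  assumes "is_proj m E" "is_proj m F" "column_space E = column_space F"
  shows "E = F"
proof -
  have EF: "E * F = F" "F * E = E"
    using assms by (auto intro!: column_space_subset_proj simp: is_proj_def)
  then have "mat_adjoint (E * F) = mat_adjoint F"
    by simp
  with assms have "F * E = F"
    by (auto simp: is_proj_def mat_adjoint_mult)
  with EF show ?thesis by simp
qed

lemma column_space_partial_isometry:
  assumes "T \<in> carrier_mat m c" "T * (mat_adjoint T * T) = T"
  shows "column_space (T * mat_adjoint T) = column_space T"
proof
  show "column_space (T * mat_adjoint T) \<subseteq> column_space T"
    using assms by (intro column_space_mult_subset) auto
  have "column_space (T * mat_adjoint T * T) \<subseteq> column_space (T * mat_adjoint T)"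
    using assms by (intro column_space_mult_subset) auto
  then show "column_space T \<subseteq> column_space (T * mat_adjoint T)"
    using assms by (simp add: mat_assoc)
qed

definition orth_proj :: "nat \<Rightarrow> quat vec set \<Rightarrow> quat mat" where
  "orth_proj m S = (THE E. is_proj m E \<and> column_space E = S)"

lemma orth_proj_column_space:
  assumes "T \<in> carrier_mat m c" "T * (mat_adjoint T * T) = T"
  shows "orth_proj m (column_space T) = T * mat_adjoint T"
  unfolding orth_proj_def
proof (rule the_equality)
  show "is_proj m (T * mat_adjoint T) \<and> column_space (T * mat_adjoint T) = column_space T"
    using partial_isometry_proj[OF assms] column_space_partial_isometry[OF assms] by simp
  then show "E = T * mat_adjoint T" if "is_proj m E \<and> column_space E = column_space T" for E
    using that by (auto intro: proj_eq_column_space)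
qed

section \<open>Orthonormal frames\<close>

definition append_col :: "quat mat \<Rightarrow> quat mat \<Rightarrow> quat mat" where
  "append_col Y u = mat (dim_row Y) (Suc (dim_col Y))
     (\<lambda>(i, j). if j < dim_col Y then Y $$ (i, j) else u $$ (i, 0))"

text \<open>
  Scaling a column by the inverse of its norm; the zero column is left unchanged, as
  \<open>1 / 0 = 0\<close>.
\<close>
definition unit_col :: "quat mat \<Rightarrow> quat mat" where
  "unit_col u = map_mat ((*\<^sub>R) (1 / sqrt (\<Sum>i<dim_row u. (norm (u $$ (i, 0)))\<^sup>2))) u"

text \<open>
  One step of the Gram-Schmidt process.
\<close>
definition gs_step :: "quat mat \<Rightarrow> quat mat \<Rightarrow> quat mat" where
  "gs_step Y w = append_col Y (unit_col (w - Y * (mat_adjoint Y * w)))"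

lemma dim_append_col [simp]:
  "dim_row (append_col Y u) = dim_row Y" "dim_col (append_col Y u) = Suc (dim_col Y)"
  by (simp_all add: append_col_def)

lemma index_append_col [simp]:
  "i < dim_row Y \<Longrightarrow> j < dim_col Y \<Longrightarrow> append_col Y u $$ (i, j) = Y $$ (i, j)"
  "i < dim_row Y \<Longrightarrow> append_col Y u $$ (i, dim_col Y) = u $$ (i, 0)"
  by (simp_all add: append_col_def)

lemma dim_unit_col [simp]: "dim_row (unit_col u) = dim_row u" "dim_col (unit_col u) = dim_col u"
  by (simp_all add: unit_col_def)

lemma mult_append_col:
  assumes "dim_col A = dim_row Y" "dim_row u = dim_row Y" "dim_col u = 1"
  shows "A * append_col Y u = append_col (A * Y) (A * u)"
proof (rule eq_matI)
  fix i j assume "i < dim_row (append_col (A * Y) (A * u))" "j < dim_col (append_col (A * Y) (A * u))"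
  then show "(A * append_col Y u) $$ (i, j) = append_col (A * Y) (A * u) $$ (i, j)"
    using assms unfolding append_col_def
    by (auto simp: mult_index simp del: index_mult_mat(1) intro!: sum.cong)
qed auto

lemma mult_scaleR_mat:
  fixes A u :: "quat mat"
  assumes "dim_col A = dim_row u"
  shows "A * map_mat ((*\<^sub>R) s) u = map_mat ((*\<^sub>R) s) (A * u)"
  by (rule eq_matI) (use assms in \<open>auto simp: mult_index scaleR_sum_right simp del: index_mult_mat(1)\<close>)

lemma mult_unit_col_zero:
  assumes "dim_col A = dim_row u" "A * u = 0\<^sub>m r c"
  shows "A * unit_col u = 0\<^sub>m r c"
  unfolding unit_col_def mult_scaleR_mat[OF assms(1)] assms(2) by (rule eq_matI) auto

lemma mult_unit_col_fixed:
  assumes "dim_col A = dim_row u" "A * u = u"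
  shows "A * unit_col u = unit_col u"
  unfolding unit_col_def mult_scaleR_mat[OF assms(1)] assms(2) ..

lemma unit_col_normalised:
  assumes u: "u \<in> carrier_mat m 1" "u \<noteq> 0\<^sub>m m 1"
  shows "mat_adjoint (unit_col u) * unit_col u = 1\<^sub>m 1"
proof -
  define r where "r = (\<Sum>i<m. (norm (u $$ (i, 0)))\<^sup>2)"
  have "rtr (mat_adjoint u * u) = r"
    by (simp add: rtr_adjoint_mult_self[OF u(1)] r_def)
  then have "r \<noteq> 0" "r \<ge> 0"
    using rtr_adjoint_mult_self_eq_0[OF u(1)] u(2) by (auto simp: r_def sum_nonneg)
  then have r: "r > 0" by simp
  show ?thesis
  proof (rule eq_matI)
    fix i j assume "i < dim_row (1\<^sub>m 1 :: quat mat)" "j < dim_col (1\<^sub>m 1 :: quat mat)"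
    then have [simp]: "i = 0" "j = 0" by auto
    have "(mat_adjoint (unit_col u) * unit_col u) $$ (0, 0)
        = (\<Sum>i<m. qcnj (unit_col u $$ (i, 0)) * unit_col u $$ (i, 0))"
      using u by (simp add: mult_index del: index_mult_mat(1))
    also have "\<dots> = (\<Sum>i<m. ((1 / r) * (norm (u $$ (i, 0)))\<^sup>2) *\<^sub>R 1)"
    proof (rule sum.cong)
      fix i assume "i \<in> {..<m}"
      then have "unit_col u $$ (i, 0) = (1 / sqrt r) *\<^sub>R u $$ (i, 0)"
        using u by (simp add: unit_col_def r_def)
      then show "qcnj (unit_col u $$ (i, 0)) * unit_col u $$ (i, 0)
          = ((1 / r) * (norm (u $$ (i, 0)))\<^sup>2) *\<^sub>R 1"
        using r by (simp only: qcnj_mult_self) (simp add: power_mult_distrib power_divide)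
    qed simp
    also have "\<dots> = ((1 / r) * r) *\<^sub>R 1"
      by (simp add: r_def scaleR_sum_left[symmetric] sum_distrib_left)
    finally show "(mat_adjoint (unit_col u) * unit_col u) $$ (i, j) = 1\<^sub>m 1 $$ (i, j)"
      using r by simp
  qed (use u in auto)
qed

lemma append_col_stiefel:
  assumes Y: "Y \<in> stiefel m l" and u: "u \<in> carrier_mat m 1"
    and o: "mat_adjoint Y * u = 0\<^sub>m l 1" and n: "mat_adjoint u * u = 1\<^sub>m 1"
  shows "append_col Y u \<in> stiefel m (Suc l)"
proof -
  note d = stiefelD(2,3)[OF Y]
  have du: "dim_row u = m" "dim_col u = 1" using u by auto
  have YY: "(\<Sum>i<m. qcnj (Y $$ (i, a)) * Y $$ (i, b)) = (if a = b then 1 else 0)"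
    if "a < l" "b < l" for a b
    using arg_cong[OF stiefelD(4)[OF Y], of "\<lambda>A. A $$ (a, b)"] that d
    by (simp add: mult_index del: index_mult_mat(1))
  have Yu: "(\<Sum>i<m. qcnj (Y $$ (i, a)) * u $$ (i, 0)) = 0" if "a < l" for a
    using arg_cong[OF o, of "\<lambda>A. A $$ (a, 0)"] that d du
    by (simp add: mult_index del: index_mult_mat(1))
  have uY: "(\<Sum>i<m. qcnj (u $$ (i, 0)) * Y $$ (i, a)) = 0" if "a < l" for a
    using arg_cong[OF Yu[OF that], of qcnj] by (simp add: qcnj_sum)
  have uu: "(\<Sum>i<m. qcnj (u $$ (i, 0)) * u $$ (i, 0)) = 1"
    using arg_cong[OF n, of "\<lambda>A. A $$ (0, 0)"] du
    by (simp add: mult_index del: index_mult_mat(1))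
  have "mat_adjoint (append_col Y u) * append_col Y u = 1\<^sub>m (Suc l)"
  proof (rule eq_matI)
    fix a b assume ab: "a < dim_row (1\<^sub>m (Suc l) :: quat mat)" "b < dim_col (1\<^sub>m (Suc l) :: quat mat)"
    have "(mat_adjoint (append_col Y u) * append_col Y u) $$ (a, b)
        = (\<Sum>i<m. qcnj (append_col Y u $$ (i, a)) * append_col Y u $$ (i, b))"
      using ab d by (simp add: mult_index del: index_mult_mat(1))
    also have "\<dots> = (\<Sum>i<m. qcnj (if a < l then Y $$ (i, a) else u $$ (i, 0))
        * (if b < l then Y $$ (i, b) else u $$ (i, 0)))"
      using ab d by (intro sum.cong) (auto simp: append_col_def)
    also have "\<dots> = 1\<^sub>m (Suc l) $$ (a, b)"
      using ab by (cases "a < l"; cases "b < l") (simp_all add: YY Yu uY uu)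
    finally show "(mat_adjoint (append_col Y u) * append_col Y u) $$ (a, b) = 1\<^sub>m (Suc l) $$ (a, b)" .
  qed (use d in auto)
  then show ?thesis
    using d by (auto simp: stiefel_def intro!: carrier_matI)
qed

lemma adjoint_mult_residual:
  assumes Y: "Y \<in> stiefel m l" and w: "w \<in> carrier_mat m 1"
  shows "mat_adjoint Y * (w - Y * (mat_adjoint Y * w)) = 0\<^sub>m l 1"
proof -
  note d = stiefelD(1-4)[OF Y]
  have c: "mat_adjoint Y \<in> carrier_mat l m" "Y * (mat_adjoint Y * w) \<in> carrier_mat m 1"
    using d w by auto
  have "mat_adjoint Y * (w - Y * (mat_adjoint Y * w))
      = mat_adjoint Y * w - mat_adjoint Y * (Y * (mat_adjoint Y * w))"
    by (rule mult_minus_distrib_mat[OF c(1) w c(2)])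
  also have "mat_adjoint Y * (Y * (mat_adjoint Y * w)) = (mat_adjoint Y * Y) * (mat_adjoint Y * w)"
    using d w by (subst mat_assoc) auto
  also have "\<dots> = mat_adjoint Y * w"
    unfolding d(4) using d w by (intro left_mult_one_mat') auto
  finally show ?thesis
    using d w by (auto intro!: eq_matI simp del: index_mult_mat(1))
qed

lemma residual_carrier:
  assumes "Y \<in> carrier_mat m l" "w \<in> carrier_mat m 1"
  shows "w - Y * (mat_adjoint Y * w) \<in> carrier_mat m 1"
  using assms by (intro minus_carrier_mat) auto

lemma gs_step_stiefel:
  assumes Y: "Y \<in> stiefel m l" and w: "w \<in> carrier_mat m 1"
    and nz: "w - Y * (mat_adjoint Y * w) \<noteq> 0\<^sub>m m 1"
  shows "gs_step Y w \<in> stiefel m (Suc l)"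
proof -
  let ?u = "w - Y * (mat_adjoint Y * w)"
  have u: "?u \<in> carrier_mat m 1"
    by (rule residual_carrier[OF stiefelD(1)[OF Y] w])
  then have "unit_col ?u \<in> carrier_mat m 1"
    by (metis carrier_matD carrier_matI dim_unit_col)
  moreover have "mat_adjoint Y * unit_col ?u = 0\<^sub>m l 1"
    using u stiefelD(2)[OF Y]
    by (intro mult_unit_col_zero adjoint_mult_residual[OF Y w]) (metis carrier_matD(1) dim_mat_adjoint(2))
  ultimately show ?thesis
    unfolding gs_step_def by (intro append_col_stiefel Y unit_col_normalised[OF u nz])
qed

text \<open>
  Gram-Schmidt does not leave the image of \<open>E\<close>: membership of the columns in this image is
  expressed by the equations \<open>E Y = Y\<close> and \<open>E w = w\<close>.
\<close>
lemma gs_step_fixed: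
  assumes E: "E \<in> carrier_mat m m" and Y: "Y \<in> carrier_mat m l" and w: "w \<in> carrier_mat m 1"
    and fixed: "E * Y = Y" "E * w = w"
  shows "E * gs_step Y w = gs_step Y w"
proof -
  let ?u = "w - Y * (mat_adjoint Y * w)"
  have u: "?u \<in> carrier_mat m 1"
    by (rule residual_carrier[OF Y w])
  then have d: "dim_row ?u = m" "dim_col ?u = 1"
    by (metis carrier_matD)+
  have c: "Y * (mat_adjoint Y * w) \<in> carrier_mat m 1"
    using Y w by auto
  have "E * ?u = E * w - E * (Y * (mat_adjoint Y * w))"
    by (rule mult_minus_distrib_mat[OF E w c])
  also have "E * (Y * (mat_adjoint Y * w)) = (E * Y) * (mat_adjoint Y * w)"
    using E Y w by (subst mat_assoc) auto
  finally have "E * unit_col ?u = unit_col ?u"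
    unfolding fixed using E d by (intro mult_unit_col_fixed) auto
  then show ?thesis
    unfolding gs_step_def using E Y d by (subst mult_append_col) (auto simp: fixed)
qed

text \<open>
  A frame is not changed by Gram-Schmidt.  This makes the local sections below pass through a
  prescribed frame, and it provides the nonvanishing at the base point.
\<close>
lemma gs_step_orthonormal:
  assumes "append_col Y w \<in> stiefel m (Suc l)" "Y \<in> carrier_mat m l" "w \<in> carrier_mat m 1"
  shows "Y \<in> stiefel m l" "w - Y * (mat_adjoint Y * w) \<noteq> 0\<^sub>m m 1" "gs_step Y w = append_col Y w"
proof -
  let ?s = "append_col Y w"
  have d: "dim_row Y = m" "dim_col Y = l" "dim_row w = m" "dim_col w = 1"
    using assms by auto
  have ss: "(\<Sum>i<m. qcnj (?s $$ (i, a)) * ?s $$ (i, b)) = (if a = b then 1 else 0)"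
    if "a < Suc l" "b < Suc l" for a b
    using arg_cong[OF stiefelD(4)[OF assms(1)], of "\<lambda>A. A $$ (a, b)"] that d
    by (simp add: mult_index del: index_mult_mat(1))
  have s: "?s $$ (i, j) = (if j < l then Y $$ (i, j) else w $$ (i, 0))" if "i < m" "j < Suc l" for i j
    using that d by (simp add: append_col_def)
  have "mat_adjoint Y * Y = 1\<^sub>m l"
  proof (rule eq_matI)
    fix a b assume "a < dim_row (1\<^sub>m l :: quat mat)" "b < dim_col (1\<^sub>m l :: quat mat)"
    then show "(mat_adjoint Y * Y) $$ (a, b) = 1\<^sub>m l $$ (a, b)"
      using ss[of a b] d by (simp add: mult_index s del: index_mult_mat(1))
  qed (use d in auto)
  then show "Y \<in> stiefel m l"
    using assms(2) by (simp add: stiefel_def)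
  have "mat_adjoint Y * w = 0\<^sub>m l 1"
  proof (rule eq_matI)
    fix a b assume "a < dim_row (0\<^sub>m l 1 :: quat mat)" "b < dim_col (0\<^sub>m l 1 :: quat mat)"
    then show "(mat_adjoint Y * w) $$ (a, b) = 0\<^sub>m l 1 $$ (a, b)"
      using ss[of a l] d by (simp add: mult_index s del: index_mult_mat(1))
  qed (use d in auto)
  then have u: "w - Y * (mat_adjoint Y * w) = w"
    using d by (auto intro!: eq_matI)
  have ww: "(\<Sum>i<m. (norm (w $$ (i, 0)))\<^sup>2) = 1"
  proof -
    have "(\<Sum>i<m. (norm (w $$ (i, 0)))\<^sup>2 *\<^sub>R (1 :: quat)) = 1"
      using ss[of l l] by (simp add: s qcnj_mult_self)
    then have "qre (\<Sum>i<m. (norm (w $$ (i, 0)))\<^sup>2 *\<^sub>R (1 :: quat)) = 1"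
      by simp
    then show ?thesis
      by (simp add: qre_sum)
  qed
  show "w - Y * (mat_adjoint Y * w) \<noteq> 0\<^sub>m m 1"
    unfolding u using ww by auto
  have "unit_col w = w"
    unfolding unit_col_def d ww by (rule eq_matI) auto
  then show "gs_step Y w = ?s"
    by (simp add: gs_step_def u)
qed

lemma stiefel_SucE:
  assumes "s \<in> stiefel m (Suc l)"
  obtains Y w where "Y \<in> carrier_mat m l" "w \<in> carrier_mat m 1" "s = append_col Y w"
proof
  show "mat m l (\<lambda>ij. s $$ ij) \<in> carrier_mat m l" "mat m 1 (\<lambda>(i, j). s $$ (i, l)) \<in> carrier_mat m 1"
    by auto
  show "s = append_col (mat m l (\<lambda>ij. s $$ ij)) (mat m 1 (\<lambda>(i, j). s $$ (i, l)))"
    using stiefelD(2,3)[OF assms] by (intro eq_matI) (auto simp: append_col_def less_Suc_eq)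
qed

section \<open>Grassmannians\<close>

lemma mult_mat_vec_index:
  fixes A :: "quat mat"
  assumes "i < dim_row A" "c \<in> carrier_vec (dim_col A)"
  shows "(A *\<^sub>v c) $ i = (\<Sum>j<dim_col A. A $$ (i, j) * c $ j)"
  using assms by (simp add: scalar_prod_def atLeast0LessThan)

lemma quat_subspace_column_space:
  assumes "A \<in> carrier_mat m l"
  shows "quat_subspace m (column_space A)"
  unfolding quat_subspace_def
proof (intro conjI ballI allI)
  have d: "dim_row A = m" "dim_col A = l" using assms by auto
  show "column_space A \<subseteq> carrier_vec m"
    using assms by (auto simp: column_space_def intro!: mult_mat_vec_carrier)
  have "A *\<^sub>v 0\<^sub>v l = 0\<^sub>v m"
    using d by (intro eq_vecI) (auto simp: mult_mat_vec_index simp del: index_mult_mat_vec)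
  then show "0\<^sub>v m \<in> column_space A"
    using d by (auto simp: column_space_def intro!: image_eqI[of _ _ "0\<^sub>v l"])
  show "v + w \<in> column_space A" if vw: "v \<in> column_space A" "w \<in> column_space A" for v w
  proof -
    obtain b c where bc: "b \<in> carrier_vec l" "c \<in> carrier_vec l" "v = A *\<^sub>v b" "w = A *\<^sub>v c"
      using vw d by (auto simp: column_space_def)
    then have "v + w = A *\<^sub>v (b + c)"
      using mult_add_distrib_mat_vec[OF assms bc(1,2)] by simp
    then show ?thesis
      using bc d by (auto simp: column_space_def)
  qed
  show "map_vec (\<lambda>z. z * a) v \<in> column_space A" if v: "v \<in> column_space A" for v a
  proof -
    obtain b where b: "b \<in> carrier_vec l" "v = A *\<^sub>v b"
      using v d by (auto simp: column_space_def)
    have "map_vec (\<lambda>z. z * a) v = A *\<^sub>v map_vec (\<lambda>z. z * a) b"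
      unfolding b(2) using b(1) d
      by (intro eq_vecI)
        (auto simp: mult_mat_vec_index sum_distrib_right mult.assoc simp del: index_mult_mat_vec)
    moreover have "map_vec (\<lambda>z. z * a) b \<in> carrier_vec l"
      using b by simp
    ultimately show ?thesis
      using d by (auto simp: column_space_def)
  qed
qed

lemma column_space_append_col_subset:
  assumes S: "quat_subspace m S" and Y: "Y \<in> carrier_mat m l" and u: "u \<in> carrier_mat m 1"
    and sub: "column_space Y \<subseteq> S" "col u 0 \<in> S"
  shows "column_space (append_col Y u) \<subseteq> S"
proof
  fix v assume "v \<in> column_space (append_col Y u)"
  then obtain c where c: "c \<in> carrier_vec (Suc l)" "v = append_col Y u *\<^sub>v c"
    using Y by (auto simp: column_space_def)
  have d: "dim_row Y = m" "dim_col Y = l" "dim_row u = m" "dim_col u = 1" using Y u by auto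
  have "v = Y *\<^sub>v vec l (($) c) + map_vec (\<lambda>z. z * c $ l) (col u 0)"
  proof (rule eq_vecI)
    fix i assume i: "i < dim_vec (Y *\<^sub>v vec l (($) c) + map_vec (\<lambda>z. z * c $ l) (col u 0))"
    then have i: "i < m" using d by simp
    have "v $ i = (\<Sum>j<Suc l. append_col Y u $$ (i, j) * c $ j)"
      using c d i by (simp add: mult_mat_vec_index del: index_mult_mat_vec sum.lessThan_Suc)
    also have "\<dots> = (\<Sum>j<l. Y $$ (i, j) * c $ j) + u $$ (i, 0) * c $ l"
      using i d index_append_col(2)[of i Y u] by simp
    finally show "v $ i = (Y *\<^sub>v vec l (($) c) + map_vec (\<lambda>z. z * c $ l) (col u 0)) $ i"
      using i d by (simp add: mult_mat_vec_index del: index_mult_mat_vec(1))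
  qed (use c d in auto)
  moreover have "Y *\<^sub>v vec l (($) c) \<in> column_space Y"
    using d by (auto simp: column_space_def)
  ultimately show "v \<in> S"
    using S sub by (auto simp: quat_subspace_def)
qed

text \<open>
  A frame of maximal length in the subspace spans it, since any further vector would allow
  one more Gram-Schmidt step; the length is bounded by \<open>stiefel_le\<close>.
\<close>
lemma quat_subspace_has_frame:
  assumes S: "quat_subspace m S"
  obtains l Y where "Y \<in> stiefel m l" "column_space Y = S"
proof -
  define Q where "Q l \<longleftrightarrow> (\<exists>Y\<in>stiefel m l. column_space Y \<subseteq> S)" for l
  have "(0\<^sub>m m 0 :: quat mat) *\<^sub>v c = 0\<^sub>v m" if "c \<in> carrier_vec 0" for c
    using that by (intro eq_vecI) (auto simp: mult_mat_vec_index simp del: index_mult_mat_vec(1))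
  then have "column_space (0\<^sub>m m 0) \<subseteq> S"
    using S by (auto simp: column_space_def quat_subspace_def)
  moreover have "0\<^sub>m m 0 \<in> stiefel m 0"
    by (auto simp: stiefel_def intro!: eq_matI)
  ultimately have "Q 0"
    by (auto simp: Q_def)
  moreover have "\<forall>l. Q l \<longrightarrow> l \<le> m"
    by (auto simp: Q_def dest: stiefel_le)
  ultimately obtain l where l: "Q l" "\<And>j. Q j \<Longrightarrow> j \<le> l"
    using GreatestI_nat[of Q 0 m] Greatest_le_nat[of Q _ m] by metis
  then obtain Y where Y: "Y \<in> stiefel m l" "column_space Y \<subseteq> S"
    by (auto simp: Q_def)
  note d = stiefelD(1-4)[OF Y(1)]
  have "v \<in> column_space Y" if v: "v \<in> S" for v
  proof (rule ccontr)
    assume nv: "v \<notin> column_space Y"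
    have cv: "v \<in> carrier_vec m"
      using v S by (auto simp: quat_subspace_def)
    define w where "w = mat m 1 (\<lambda>(i, j). v $ i)"
    define u where "u = w - Y * (mat_adjoint Y * w)"
    have w: "w \<in> carrier_mat m 1" by (simp add: w_def)
    have u: "u \<in> carrier_mat m 1"
      unfolding u_def by (rule residual_carrier[OF d(1) w])
    define y where "y = Y *\<^sub>v (mat_adjoint Y *\<^sub>v v)"
    have yY: "y \<in> column_space Y"
      using d cv unfolding y_def column_space_def
      by (intro imageI) (auto intro!: mult_mat_vec_carrier[where n = m])
    have cy: "y \<in> carrier_vec m"
      using yY Y(2) S by (auto simp: quat_subspace_def)
    have uy: "col u 0 = v - y"
    proof -
      have "col w 0 = v"
        using cv by (auto simp: w_def intro!: eq_vecI)
      moreover have "col (Y * (mat_adjoint Y * w)) 0 = y"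
        unfolding y_def using d w \<open>col w 0 = v\<close>
        by (subst col_mult2[of _ m l _ 1]) (auto simp: col_mult2[of _ l m _ 1])
      moreover have "col u 0 = col w 0 - col (Y * (mat_adjoint Y * w)) 0"
        unfolding u_def using w d by (intro eq_vecI) auto
      ultimately show ?thesis by simp
    qed
    have "u \<noteq> 0\<^sub>m m 1"
    proof
      assume "u = 0\<^sub>m m 1"
      then have "v - y = 0\<^sub>v m"
        using uy by (auto intro!: eq_vecI)
      then have "(v - y) $ i = 0" if "i < m" for i
        using that by simp
      then have "v = y"
        using cv cy by (intro eq_vecI) auto
      then show False
        using nv yY by simp
    qed
    then have "gs_step Y w \<in> stiefel m (Suc l)"
      unfolding u_def by (rule gs_step_stiefel[OF Y(1) w])
    moreover have "column_space (gs_step Y w) \<subseteq> S"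
      unfolding gs_step_def u_def[symmetric]
    proof (rule column_space_append_col_subset[OF S d(1) _ Y(2)])
      show "unit_col u \<in> carrier_mat m 1"
        using u by (metis carrier_matD carrier_matI dim_unit_col)
      obtain r where r: "unit_col u = map_mat ((*\<^sub>R) r) u"
        by (auto simp: unit_col_def)
      \<comment> \<open>Real numbers commute with quaternions, so scaling by \<open>r\<close> is a scalar multiplication on the right.\<close>
      have "v + map_vec (\<lambda>z. z * (- 1)) y \<in> S"
        using S v yY Y(2) unfolding quat_subspace_def by blast
      then have "map_vec (\<lambda>z. z * (of_real r)) (v + map_vec (\<lambda>z. z * (- 1)) y) \<in> S"
        using S unfolding quat_subspace_def by blast
      also have "map_vec (\<lambda>z. z * (of_real r)) (v + map_vec (\<lambda>z. z * (- 1)) y) = col (unit_col u) 0"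
      proof -
        have "col (unit_col u) 0 = map_vec ((*\<^sub>R) r) (v - y)"
          unfolding uy[symmetric] r using u by (intro eq_vecI) auto
        then show ?thesis
          using cv cy by (auto intro!: eq_vecI simp: of_real_def)
      qed
      finally show "col (unit_col u) 0 \<in> S" .
    qed
    ultimately have "Q (Suc l)"
      by (auto simp: Q_def)
    then show False
      using l(2) by force
  qed
  then show ?thesis
    using that Y by blast
qed

lemma column_space_subset_factor:
  assumes A: "A \<in> carrier_mat m l" and X: "X \<in> carrier_mat m c"
    and sub: "column_space X \<subseteq> column_space A"
  obtains C where "C \<in> carrier_mat l c" "X = A * C"
proof -
  have "\<exists>b\<in>carrier_vec l. col X j = A *\<^sub>v b" if j: "j < c" for j
  proof -
    have "X *\<^sub>v unit_vec c j = col X j"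
      using X j by (intro eq_vecI) (auto simp: scalar_prod_def if_distrib sum.If_cases cong: if_cong)
    then have "col X j \<in> column_space X"
      using X unfolding column_space_def by (metis (no_types) carrier_matD(2) imageI unit_vec_carrier)
    then show ?thesis
      using sub A by (auto simp: column_space_def)
  qed
  then obtain b where b: "b j \<in> carrier_vec l" "col X j = A *\<^sub>v b j" if "j < c" for j
    by metis
  show ?thesis
  proof
    show C: "mat l c (\<lambda>(i, j). b j $ i) \<in> carrier_mat l c" by simp
    show "X = A * mat l c (\<lambda>(i, j). b j $ i)"
    proof (rule eq_matI)
      fix i j assume "i < dim_row (A * mat l c (\<lambda>(i, j). b j $ i))"
        "j < dim_col (A * mat l c (\<lambda>(i, j). b j $ i))"
      then have ij: "i < m" "j < c" using A by auto
      have "X $$ (i, j) = (A *\<^sub>v b j) $ i"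
        using ij X b(2)[OF ij(2)] by (metis carrier_matD index_col)
      also have "\<dots> = (\<Sum>l<l. A $$ (i, l) * b j $ l)"
        using ij A b(1)[OF ij(2)] by (simp add: mult_mat_vec_index del: index_mult_mat_vec(1))
      finally show "X $$ (i, j) = (A * mat l c (\<lambda>(i, j). b j $ i)) $$ (i, j)"
        using ij A by (simp add: mult_index del: index_mult_mat(1))
    qed (use A X in auto)
  qed
qed

text \<open>
  A subspace with a basis \<open>A\<close> of \<open>l\<close> vectors also has a frame \<open>Y\<close>, of some length \<open>l'\<close>.  Expressing
  each through the other gives \<open>R C = 1\<close> and \<open>C R = 1\<close>, and the traces of these identity matrices
  are \<open>l'\<close> and \<open>l\<close>.
\<close>
lemma grassmannian_iff_frame:
  "S \<in> grassmannian m l \<longleftrightarrow> (\<exists>Y\<in>stiefel m l. column_space Y = S)"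
proof
  assume "\<exists>Y\<in>stiefel m l. column_space Y = S"
  then obtain Y where Y: "Y \<in> stiefel m l" "column_space Y = S" by auto
  note d = stiefelD(1-4)[OF Y(1)]
  have "c = 0\<^sub>v l" if c: "c \<in> carrier_vec l" "Y *\<^sub>v c = 0\<^sub>v m" for c
  proof -
    have "c = 1\<^sub>m l *\<^sub>v c"
      using c(1) by simp
    also have "\<dots> = mat_adjoint Y *\<^sub>v (Y *\<^sub>v c)"
      unfolding d(4)[symmetric] using c d by (intro assoc_mult_mat_vec[of _ l m _ l]) auto
    also have "\<dots> = 0\<^sub>v l"
      unfolding c(2) using d by (intro eq_vecI) (auto simp: mult_mat_vec_index simp del: index_mult_mat_vec(1))
    finally show ?thesis .
  qed
  then have "independent_columns Y"
    using d by (auto simp: independent_columns_def)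
  then show "S \<in> grassmannian m l"
    unfolding grassmannian_def using Y(2) d(1) quat_subspace_column_space[OF d(1)] by auto
next
  assume "S \<in> grassmannian m l"
  then obtain A where S: "quat_subspace m S" and A: "A \<in> carrier_mat m l" "independent_columns A"
    and AS: "column_space A = S"
    by (auto simp: grassmannian_def)
  obtain l' Y where Y: "Y \<in> stiefel m l'" "column_space Y = S"
    by (rule quat_subspace_has_frame[OF S])
  note d = stiefelD(1-4)[OF Y(1)]
  obtain R where R: "R \<in> carrier_mat l' l" "A = Y * R"
    using column_space_subset_factor[OF d(1) A(1)] Y AS by blast
  obtain C where C: "C \<in> carrier_mat l l'" "Y = A * C"
    using column_space_subset_factor[OF A(1) d(1)] Y AS by blast
  have RC: "R * C = 1\<^sub>m l'"
  proof -
    have "R * C = mat_adjoint Y * Y * (R * C)"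
      unfolding d(4) using R C by simp
    also have "\<dots> = mat_adjoint Y * (Y * R * C)"
      using R(1) C(1) d(1-3) by (simp add: mat_assoc)
    also have "\<dots> = 1\<^sub>m l'"
      using R(2) C(2) d(4) by simp
    finally show ?thesis .
  qed
  have CR: "C * R = 1\<^sub>m l"
  proof (rule mat_eq_vecI)
    fix v :: "quat vec" assume v: "v \<in> carrier_vec l"
    have cr: "C * R \<in> carrier_mat l l" "C * R *\<^sub>v v \<in> carrier_vec l"
      using C(1) R(1) v by (auto intro!: mult_mat_vec_carrier[of _ l l])
    have "A *\<^sub>v (C * R *\<^sub>v v) = A * (C * R) *\<^sub>v v"
      by (rule assoc_mult_mat_vec[OF A(1) cr(1) v, symmetric])
    also have "A * (C * R) = A * C * R"
      using A(1) C(1) R(1) by (simp add: mat_assoc)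
    also have "\<dots> = A"
      using C(2) R(2) by simp
    finally have "A *\<^sub>v (C * R *\<^sub>v v - v) = 0\<^sub>v m"
      using mult_minus_distrib_mat_vec[OF A(1) cr(2) v] A(1) v by (auto intro!: eq_vecI)
    then have "C * R *\<^sub>v v - v = 0\<^sub>v l"
      using A cr v by (auto simp: independent_columns_def)
    then have "(C * R *\<^sub>v v - v) $ i = 0" if "i < l" for i
      using that by simp
    then have "C * R *\<^sub>v v = v"
      using cr v by (intro eq_vecI) (auto simp del: index_mult_mat_vec(1))
    then show "C * R *\<^sub>v v = 1\<^sub>m l *\<^sub>v v"
      using v by simp
  qed (use C(1) R(1) in auto)
  have "real l' = real l"
    using rtr_mult_commute[OF R(1) C(1)] by (simp add: RC CR)
  then show "\<exists>Y\<in>stiefel m l. column_space Y = S"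
    using Y by auto
qed

section \<open>Continuity of matrix operations\<close>

lemma topspace_mat_topology [simp]: "topspace (mat_topology r c) = carrier_mat r c"
  by (auto simp: mat_topology_def topspace_pullback_topology)

lemma topspace_stiefel_topology [simp]: "topspace (stiefel_topology m l) = stiefel m l"
  by (auto simp: stiefel_topology_def stiefel_def)

lemma continuous_map_mat_index:
  assumes "i < r" "j < c"
  shows "continuous_map (mat_topology r c) euclidean (\<lambda>A. A $$ (i, j))"
proof -
  have "continuous_map (mat_topology r c) euclidean
      ((\<lambda>f. f (i, j)) \<circ> (\<lambda>A. restrict (($$) A) ({..<r} \<times> {..<c})))"
    unfolding mat_topology_def using assms
    by (intro continuous_map_pullback continuous_map_product_projection) auto
  then show ?thesis
    using assms by (simp add: o_def)
qed

text \<open>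
  The topology of matrices is the initial one for the entries, so continuity can be checked
  entry by entry.
\<close>
lemma continuous_map_mat_iff:
  "continuous_map X (mat_topology r c) f \<longleftrightarrow>
     f \<in> topspace X \<rightarrow> carrier_mat r c \<and>
     (\<forall>i<r. \<forall>j<c. continuous_map X euclidean (\<lambda>x. f x $$ (i, j)))"
proof (intro iffI conjI allI impI)
  assume f: "continuous_map X (mat_topology r c) f"
  then show "f \<in> topspace X \<rightarrow> carrier_mat r c"
    using continuous_map_funspace by fastforce
  show "continuous_map X euclidean (\<lambda>x. f x $$ (i, j))" if "i < r" "j < c" for i j
    using continuous_map_compose[OF f continuous_map_mat_index[OF that]] by (simp add: o_def)
next
  assume *: "f \<in> topspace X \<rightarrow> carrier_mat r c \<and>
     (\<forall>i<r. \<forall>j<c. continuous_map X euclidean (\<lambda>x. f x $$ (i, j)))"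
  show "continuous_map X (mat_topology r c) f"
    unfolding mat_topology_def
  proof (rule continuous_map_pullback')
    show "topspace X \<subseteq> f -` carrier_mat r c"
      using * by auto
    show "continuous_map X (product_topology (\<lambda>_. euclidean) ({..<r} \<times> {..<c}))
        ((\<lambda>A. restrict (($$) A) ({..<r} \<times> {..<c})) \<circ> f)"
      using * by (auto simp: continuous_map_componentwise)
  qed
qed

lemma continuous_map_mat_carrier:
  "continuous_map X (mat_topology r c) f \<Longrightarrow> x \<in> topspace X \<Longrightarrow> f x \<in> carrier_mat r c"
  by (auto simp: continuous_map_mat_iff)

lemma bounded_linear_qcnj: "bounded_linear qcnj"
  by (rule bounded_linear_intro[where K = 1]) auto

lemma continuous_map_quat_mult:
  fixes f g :: "'a \<Rightarrow> quat"
  shows "continuous_map X euclidean f \<Longrightarrow> continuous_map X euclidean g \<Longrightarrow>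
    continuous_map X euclidean (\<lambda>x. f x * g x)"
  by (simp add: continuous_map_atin tendsto_mult)

lemma continuous_map_quat_scaleR:
  fixes g :: "'a \<Rightarrow> quat"
  shows "continuous_map X euclideanreal f \<Longrightarrow> continuous_map X euclidean g \<Longrightarrow>
    continuous_map X euclidean (\<lambda>x. f x *\<^sub>R g x)"
  by (simp add: continuous_map_atin tendsto_scaleR)

lemma continuous_map_qcnj:
  "continuous_map X euclidean f \<Longrightarrow> continuous_map X euclidean (\<lambda>x. qcnj (f x))"
  by (simp add: continuous_map_atin bounded_linear.tendsto[OF bounded_linear_qcnj])

lemma continuous_map_mat_mult:
  assumes "continuous_map X (mat_topology r m) f" "continuous_map X (mat_topology m c) g"
  shows "continuous_map X (mat_topology r c) (\<lambda>x. f x * g x)"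
  unfolding continuous_map_mat_iff
proof (intro conjI allI impI)
  note car = continuous_map_mat_carrier[OF assms(1)] continuous_map_mat_carrier[OF assms(2)]
  show "(\<lambda>x. f x * g x) \<in> topspace X \<rightarrow> carrier_mat r c"
    using car by (auto intro: mult_carrier_mat)
  fix i j assume ij: "i < r" "j < c"
  have "continuous_map X euclidean (\<lambda>x. \<Sum>l<m. f x $$ (i, l) * g x $$ (l, j))"
    using assms ij by (intro continuous_map_sum continuous_map_quat_mult) (auto simp: continuous_map_mat_iff)
  then show "continuous_map X euclidean (\<lambda>x. (f x * g x) $$ (i, j))"
    by (rule continuous_map_eq) (use car ij in \<open>force simp: mult_index simp del: index_mult_mat(1)\<close>)
qed

lemma continuous_map_mat_adjoint:
  assumes "continuous_map X (mat_topology r c) f"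
  shows "continuous_map X (mat_topology c r) (\<lambda>x. mat_adjoint (f x))"
  unfolding continuous_map_mat_iff
proof (intro conjI allI impI)
  note car = continuous_map_mat_carrier[OF assms(1)]
  show "(\<lambda>x. mat_adjoint (f x)) \<in> topspace X \<rightarrow> carrier_mat c r"
    using car by auto
  fix i j assume ij: "i < c" "j < r"
  then have "continuous_map X euclidean (\<lambda>x. qcnj (f x $$ (j, i)))"
    using assms by (intro continuous_map_qcnj) (auto simp: continuous_map_mat_iff)
  then show "continuous_map X euclidean (\<lambda>x. mat_adjoint (f x) $$ (i, j))"
    by (rule continuous_map_eq) (use car ij in force)
qed

lemma continuous_map_mat_minus:
  assumes "continuous_map X (mat_topology r c) f" "continuous_map X (mat_topology r c) g"
  shows "continuous_map X (mat_topology r c) (\<lambda>x. f x - g x)"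
  unfolding continuous_map_mat_iff
proof (intro conjI allI impI)
  note car = continuous_map_mat_carrier[OF assms(1)] continuous_map_mat_carrier[OF assms(2)]
  show "(\<lambda>x. f x - g x) \<in> topspace X \<rightarrow> carrier_mat r c"
    using car by (auto intro: minus_carrier_mat)
  fix i j assume ij: "i < r" "j < c"
  then have "continuous_map X euclidean (\<lambda>x. f x $$ (i, j) - g x $$ (i, j))"
    using assms by (intro continuous_map_diff) (auto simp: continuous_map_mat_iff)
  then show "continuous_map X euclidean (\<lambda>x. (f x - g x) $$ (i, j))"
    by (rule continuous_map_eq) (use car ij in force)
qed

lemma continuous_map_mat_append_col:
  assumes "continuous_map X (mat_topology r c) f" "continuous_map X (mat_topology r 1) g"
  shows "continuous_map X (mat_topology r (Suc c)) (\<lambda>x. append_col (f x) (g x))"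
  unfolding continuous_map_mat_iff
proof (intro conjI allI impI)
  note car = continuous_map_mat_carrier[OF assms(1)] continuous_map_mat_carrier[OF assms(2)]
  show "(\<lambda>x. append_col (f x) (g x)) \<in> topspace X \<rightarrow> carrier_mat r (Suc c)"
    using car(1) unfolding append_col_def by force
  fix i j assume ij: "i < r" "j < Suc c"
  then have "continuous_map X euclidean (\<lambda>x. if j < c then f x $$ (i, j) else g x $$ (i, 0))"
    using assms by (auto simp: continuous_map_mat_iff)
  then show "continuous_map X euclidean (\<lambda>x. append_col (f x) (g x) $$ (i, j))"
    by (rule continuous_map_eq) (use car(1) ij in \<open>force simp: append_col_def\<close>)
qed

lemma continuous_map_col_norm:
  assumes "continuous_map X (mat_topology r 1) f"
  shows "continuous_map X euclideanreal (\<lambda>x. \<Sum>i<r. (norm (f x $$ (i, 0)))\<^sup>2)"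
  using assms
  by (intro continuous_map_sum continuous_map_real_pow continuous_map_norm)
    (auto simp: continuous_map_mat_iff)

lemma col_norm_eq_0_iff:
  fixes u :: "quat mat"
  assumes "u \<in> carrier_mat r 1"
  shows "(\<Sum>i<r. (norm (u $$ (i, 0)))\<^sup>2) = 0 \<longleftrightarrow> u = 0\<^sub>m r 1"
  using rtr_adjoint_mult_self_eq_0[of u r 1] assms by (auto simp: rtr_adjoint_mult_self[OF assms])

lemma continuous_map_unit_col:
  assumes "continuous_map X (mat_topology r 1) f" "\<And>x. x \<in> topspace X \<Longrightarrow> f x \<noteq> 0\<^sub>m r 1"
  shows "continuous_map X (mat_topology r 1) (\<lambda>x. unit_col (f x))"
  unfolding continuous_map_mat_iff
proof (intro conjI allI impI)
  note car = continuous_map_mat_carrier[OF assms(1)]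
  show "(\<lambda>x. unit_col (f x)) \<in> topspace X \<rightarrow> carrier_mat r 1"
    using car unfolding unit_col_def by force
  fix i j :: nat assume ij: "i < r" "j < 1"
  let ?n = "\<lambda>x. sqrt (\<Sum>i<r. (norm (f x $$ (i, 0)))\<^sup>2)"
  have "continuous_map X euclidean (\<lambda>x. (1 / ?n x) *\<^sub>R f x $$ (i, 0))"
  proof (intro continuous_map_quat_scaleR continuous_map_real_divide continuous_map_sqrt
      continuous_map_col_norm assms(1))
    show "?n x \<noteq> 0" if "x \<in> topspace X" for x
      using assms(2)[OF that] col_norm_eq_0_iff[OF car[OF that]] by simp
    show "continuous_map X euclidean (\<lambda>x. f x $$ (i, 0))"
      using assms(1) ij by (auto simp: continuous_map_mat_iff)
  qed auto
  then show "continuous_map X euclidean (\<lambda>x. unit_col (f x) $$ (i, j))"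
    by (rule continuous_map_eq) (use car ij in \<open>force simp: unit_col_def\<close>)
qed

section \<open>Local sections over the Grassmannian\<close>

text \<open>
  The induction adds the columns of \<open>s\<close> one at a time, and \<open>f E\<close> is the Gram-Schmidt process applied
  to \<open>E s\<close>.  The neighbourhood \<open>V\<close> shrinks in each step to where the new residual does not vanish.
  The projection \<open>E0\<close> is only required to fix \<open>s\<close>, not to be \<open>s s\<^sup>*\<close>: in this form the induction
  hypothesis applies to the shorter frame with the same \<open>E0\<close>.
\<close>
lemma local_frames_of_projections:
  assumes "is_proj m E0" "s \<in> stiefel m l" "E0 * s = s"
  shows "\<exists>V f. openin (mat_topology m m) V \<and> E0 \<in> V \<and>
    continuous_map (subtopology (mat_topology m m) V) (mat_topology m l) f \<and> f E0 = s \<and>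
    (\<forall>E\<in>V. f E \<in> stiefel m l \<and> (E * E = E \<longrightarrow> E * f E = f E))"
  using assms(2,3)
proof (induction l arbitrary: s)
  case 0
  let ?V = "carrier_mat m m :: quat mat set"
  have s: "s \<in> carrier_mat m 0" by (rule stiefelD(1)[OF 0(1)])
  have "openin (mat_topology m m) ?V"
    by (metis openin_topspace topspace_mat_topology)
  moreover have "E0 \<in> ?V" using assms(1) by (simp add: is_proj_def)
  moreover have "E * s = s" if "E \<in> ?V" for E
    using that s by (intro eq_matI) auto
  moreover have "continuous_map (subtopology (mat_topology m m) ?V) (mat_topology m 0) (\<lambda>_. s)"
    using s by simp
  ultimately show ?case
    using 0(1) by (intro exI[of _ ?V] exI[of _ "\<lambda>_. s"]) auto
next
  case (Suc l)
  have E0: "E0 \<in> carrier_mat m m" "E0 * E0 = E0" using assms(1) by (auto simp: is_proj_def)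
  obtain Y w where Y: "Y \<in> carrier_mat m l" and w: "w \<in> carrier_mat m 1" and s: "s = append_col Y w"
    by (rule stiefel_SucE[OF Suc.prems(1)])
  note gs = gs_step_orthonormal[OF Suc.prems(1)[unfolded s] Y w]
  have dims: "dim_row Y = m" "dim_col Y = l" "dim_row w = m" "dim_col w = 1" "dim_row E0 = m" "dim_col E0 = m"
    using Y w E0 by auto
  have app: "append_col (E0 * Y) (E0 * w) = append_col Y w"
    using Suc.prems(2) dims unfolding s by (subst (asm) mult_append_col) auto
  have EY: "E0 * Y = Y"
  proof (rule eq_matI)
    fix i j assume "i < dim_row Y" "j < dim_col Y"
    then show "(E0 * Y) $$ (i, j) = Y $$ (i, j)"
      using arg_cong[OF app, of "\<lambda>A. A $$ (i, j)"] dims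
      by (simp add: append_col_def del: index_mult_mat(1))
  qed (use dims in auto)
  have Ew: "E0 * w = w"
  proof (rule eq_matI)
    fix i j assume "i < dim_row w" "j < dim_col w"
    then show "(E0 * w) $$ (i, j) = w $$ (i, j)"
      using arg_cong[OF app, of "\<lambda>A. A $$ (i, l)"] dims
      by (simp add: append_col_def del: index_mult_mat(1))
  qed (use dims in auto)
  obtain V f where V: "openin (mat_topology m m) V" "E0 \<in> V"
    and f: "continuous_map (subtopology (mat_topology m m) V) (mat_topology m l) f" "f E0 = Y"
    and fV: "\<And>E. E \<in> V \<Longrightarrow> f E \<in> stiefel m l" "\<And>E. E \<in> V \<Longrightarrow> E * E = E \<Longrightarrow> E * f E = f E"
    using Suc.IH[OF gs(1) EY] by blast
  have VC: "V \<subseteq> carrier_mat m m"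
    using openin_subset[OF V(1)] by simp
  let ?X = "subtopology (mat_topology m m) V"
  have topX: "topspace ?X = V"
    using VC by auto
  define u where "u E = E * w - f E * (mat_adjoint (f E) * (E * w))" for E
  have cw: "continuous_map ?X (mat_topology m 1) (\<lambda>E. E * w)"
  proof (rule continuous_map_mat_mult)
    show "continuous_map ?X (mat_topology m m) (\<lambda>E. E)"
      by (simp add: continuous_map_from_subtopology)
    show "continuous_map ?X (mat_topology m 1) (\<lambda>E. w)"
      using w by simp
  qed
  have cu: "continuous_map ?X (mat_topology m 1) u"
    unfolding u_def
    by (rule continuous_map_mat_minus[OF cw continuous_map_mat_mult[OF f(1)
          continuous_map_mat_mult[OF continuous_map_mat_adjoint[OF f(1)] cw]]])
  have uc: "u E \<in> carrier_mat m 1" if "E \<in> V" for E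
    using continuous_map_mat_carrier[OF cu] that unfolding topX by blast
  define W where "W = {E \<in> V. u E \<noteq> 0\<^sub>m m 1}"
  have "openin ?X {E \<in> topspace ?X. (\<Sum>i<m. (norm (u E $$ (i, 0)))\<^sup>2) \<in> - {0}}"
    by (rule openin_continuous_map_preimage[OF continuous_map_col_norm[OF cu]]) auto
  also have "{E \<in> topspace ?X. (\<Sum>i<m. (norm (u E $$ (i, 0)))\<^sup>2) \<in> - {0}} = W"
    unfolding topX W_def using col_norm_eq_0_iff[OF uc] by auto
  finally have W: "openin (mat_topology m m) W"
    using V(1) by (rule openin_trans_full)
  have topW: "topspace (subtopology (mat_topology m m) W) = W"
    using VC by (auto simp: W_def)
  have sub: "continuous_map (subtopology (mat_topology m m) W) T g" if "continuous_map ?X T g"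
    for T :: "quat mat topology" and g
    using that by (rule continuous_map_from_subtopology_mono) (auto simp: W_def)
  define g where "g E = gs_step (f E) (E * w)" for E
  have "continuous_map (subtopology (mat_topology m m) W) (mat_topology m (Suc l)) g"
    unfolding g_def gs_step_def u_def[symmetric]
    by (intro continuous_map_mat_append_col continuous_map_unit_col sub f(1) cu)
      (use topW in \<open>auto simp: W_def\<close>)
  moreover have "g E0 = s"
    by (simp add: g_def f(2) Ew gs(3) s)
  moreover have "E0 \<in> W"
    using V(2) gs(2) by (simp add: W_def u_def f(2) Ew)
  moreover have "g E \<in> stiefel m (Suc l) \<and> (E * E = E \<longrightarrow> E * g E = g E)" if E: "E \<in> W" for E
  proof (intro conjI impI)
    have EV: "E \<in> V" "u E \<noteq> 0\<^sub>m m 1" and Ec: "E \<in> carrier_mat m m" and Ewc: "E * w \<in> carrier_mat m 1"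
      using E VC w by (auto simp: W_def)
    show "g E \<in> stiefel m (Suc l)"
      unfolding g_def by (rule gs_step_stiefel[OF fV(1)[OF EV(1)] Ewc EV(2)[unfolded u_def]])
    assume EE: "E * E = E"
    have "E * (E * w) = E * w"
      using Ec w by (subst mat_assoc[symmetric]) (auto simp: EE)
    then show "E * g E = g E"
      unfolding g_def by (intro gs_step_fixed[OF Ec stiefelD(1)[OF fV(1)] Ewc fV(2)] EV EE)
  qed
  ultimately show ?case
    using W by blast
qed

lemma orth_proj_frame:
  assumes "Y \<in> stiefel m l"
  shows "orth_proj m (column_space Y) = Y * mat_adjoint Y"
  by (rule orth_proj_column_space[OF stiefelD(1,5)[OF assms]])

lemma orth_proj_grassmannian:
  assumes "S \<in> grassmannian m l"
  shows "is_proj m (orth_proj m S)" "rtr (orth_proj m S) = real l" "column_space (orth_proj m S) = S"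
proof -
  obtain Y where Y: "Y \<in> stiefel m l" "column_space Y = S"
    using assms by (auto simp: grassmannian_iff_frame)
  have "orth_proj m S = Y * mat_adjoint Y"
    using orth_proj_frame[OF Y(1)] by (simp add: Y(2))
  then show "is_proj m (orth_proj m S)" "rtr (orth_proj m S) = real l" "column_space (orth_proj m S) = S"
    using stiefelD[OF Y(1)] Y(2) column_space_partial_isometry[OF stiefelD(1,5)[OF Y(1)]] by auto
qed

text \<open>
  A frame inside the image of a projection spans this image if its length is the trace.
\<close>
lemma frame_of_proj:
  assumes E: "is_proj m E" "rtr E = real l" and Y: "Y \<in> stiefel m l" "E * Y = Y"
  shows "Y * mat_adjoint Y = E" "column_space Y = column_space E"
proof -
  have "E * (Y * mat_adjoint Y) = (E * Y) * mat_adjoint Y"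
    using E(1) stiefelD(2)[OF Y(1)] by (subst mat_assoc) (auto simp: is_proj_def)
  then show "Y * mat_adjoint Y = E"
    using proj_eqI[OF E(1) stiefelD(6)[OF Y(1)]] E(2) Y(2) stiefelD(7)[OF Y(1)] by auto
  then show "column_space Y = column_space E"
    using column_space_partial_isometry[OF stiefelD(1,5)[OF Y(1)]] by simp
qed

lemma topspace_grassmannian_topology [simp]:
  "topspace (grassmannian_topology m l) = grassmannian m l"
proof -
  have "{x \<in> stiefel m l. column_space x \<in> grassmannian m l} = topspace (stiefel_topology m l)"
    by (auto simp: grassmannian_iff_frame)
  then have "openin (grassmannian_topology m l) (grassmannian m l)"
    unfolding openin_grassmannian_topology by (metis openin_topspace subset_refl)
  then show ?thesis
    by (metis openin_grassmannian_topology openin_subset openin_topspace subset_antisym)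
qed

text \<open>
  The Grassmannian carries the quotient topology by definition; the frames of a subspace make the
  map surjective.
\<close>
lemma quotient_map_column_space:
  "quotient_map (stiefel_topology m l) (grassmannian_topology m l) column_space"
  unfolding quotient_map_def
  by (auto simp: openin_grassmannian_topology grassmannian_iff_frame image_iff)

lemma continuous_map_orth_proj:
  "continuous_map (grassmannian_topology m l) (mat_topology m m) (orth_proj m)"
proof (rule continuous_compose_quotient_map[OF quotient_map_column_space])
  have "continuous_map (stiefel_topology m l) (mat_topology m l) (\<lambda>Y. Y)"
    unfolding stiefel_topology_def by (simp add: continuous_map_from_subtopology)
  then have "continuous_map (stiefel_topology m l) (mat_topology m m) (\<lambda>Y. Y * mat_adjoint Y)"
    by (intro continuous_map_mat_mult[where m = l] continuous_map_mat_adjoint)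
  then show "continuous_map (stiefel_topology m l) (mat_topology m m) (orth_proj m \<circ> column_space)"
    by (rule continuous_map_eq) (simp add: orth_proj_frame)
qed

text \<open>
  The neighbourhood \<open>V\<close> is taken in the space of all matrices rather than in the Grassmannian.  This
  is what allows its use both for the continuity of maps into the Grassmannian and for
  the construction of sections over it.
\<close>
lemma local_frames_of_subspaces:
  assumes "S0 \<in> grassmannian m l"
  shows "\<exists>V f. openin (mat_topology m m) V \<and> orth_proj m S0 \<in> V \<and>
    continuous_map (subtopology (mat_topology m m) V) (mat_topology m l) f \<and>
    (\<forall>S\<in>grassmannian m l. orth_proj m S \<in> V \<longrightarrow>
       f (orth_proj m S) \<in> stiefel m l \<and> column_space (f (orth_proj m S)) = S)"
proof -
  obtain s where s: "s \<in> stiefel m l" "column_space s = S0"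
    using assms by (auto simp: grassmannian_iff_frame)
  have "orth_proj m S0 * s = s"
    using orth_proj_frame[OF s(1)] stiefelD(2,3,5)[OF s(1)] by (simp add: s(2) mat_assoc)
  from local_frames_of_projections[OF orth_proj_grassmannian(1)[OF assms] s(1) this]
  obtain V f where V: "openin (mat_topology m m) V" "orth_proj m S0 \<in> V"
    "continuous_map (subtopology (mat_topology m m) V) (mat_topology m l) f"
    and f: "\<And>E. E \<in> V \<Longrightarrow> f E \<in> stiefel m l" "\<And>E. E \<in> V \<Longrightarrow> E * E = E \<Longrightarrow> E * f E = f E"
    by blast
  have "column_space (f (orth_proj m S)) = S" if S: "S \<in> grassmannian m l" "orth_proj m S \<in> V" for S
  proof -
    note P = orth_proj_grassmannian[OF S(1)]
    have "orth_proj m S * f (orth_proj m S) = f (orth_proj m S)"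
      using P(1) by (intro f(2) S(2)) (simp add: is_proj_def)
    from frame_of_proj(2)[OF P(1,2) f(1)[OF S(2)] this] show ?thesis
      by (simp add: P(3))
  qed
  then show ?thesis
    using V f(1) by blast
qed

text \<open>
  Near a given point, \<open>g\<close> factors through the Stiefel manifold: it takes a point to the span of the
  frame that is assigned to the projection onto its value.
\<close>
lemma continuous_map_grassmannianI:
  assumes g: "\<And>x. x \<in> topspace X \<Longrightarrow> g x \<in> grassmannian m l"
    and c: "continuous_map X (mat_topology m m) (\<lambda>x. orth_proj m (g x))"
  shows "continuous_map X (grassmannian_topology m l) g"
proof -
  have "\<exists>W. openin X W \<and> x0 \<in> W \<and> continuous_map (subtopology X W) (grassmannian_topology m l) g"
    if x0: "x0 \<in> topspace X" for x0
  proof -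
    obtain V f where V: "openin (mat_topology m m) V" "orth_proj m (g x0) \<in> V"
      and f: "continuous_map (subtopology (mat_topology m m) V) (mat_topology m l) f"
      and fV: "\<And>S. S \<in> grassmannian m l \<Longrightarrow> orth_proj m S \<in> V \<Longrightarrow>
         f (orth_proj m S) \<in> stiefel m l \<and> column_space (f (orth_proj m S)) = S"
      using local_frames_of_subspaces[OF g[OF x0]] by blast
    define W where "W = {x \<in> topspace X. orth_proj m (g x) \<in> V}"
    have W: "openin X W"
      unfolding W_def by (rule openin_continuous_map_preimage[OF c V(1)])
    have topW: "topspace (subtopology X W) = W"
      by (auto simp: W_def)
    have "continuous_map (subtopology X W) (subtopology (mat_topology m m) V) (\<lambda>x. orth_proj m (g x))"
      using continuous_map_from_subtopology[OF c]
      by (auto simp: continuous_map_in_subtopology W_def)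
    from continuous_map_compose[OF this f]
    have "continuous_map (subtopology X W) (mat_topology m l) (\<lambda>x. f (orth_proj m (g x)))"
      by (simp add: o_def)
    then have "continuous_map (subtopology X W) (stiefel_topology m l) (\<lambda>x. f (orth_proj m (g x)))"
      unfolding stiefel_topology_def continuous_map_in_subtopology topW
      using fV g by (auto simp: W_def)
    from continuous_map_compose[OF this quotient_imp_continuous_map[OF quotient_map_column_space]]
    have "continuous_map (subtopology X W) (grassmannian_topology m l)
        (\<lambda>x. column_space (f (orth_proj m (g x))))"
      by (simp add: o_def)
    then have "continuous_map (subtopology X W) (grassmannian_topology m l) g"
      by (rule continuous_map_eq) (use fV g in \<open>auto simp: W_def\<close>)
    then show ?thesis
      using W x0 V(2) by (auto simp: W_def)
  qed
  then obtain W where W: "\<And>x. x \<in> topspace X \<Longrightarrow> openin X (W x)" "\<And>x. x \<in> topspace X \<Longrightarrow> x \<in> W x"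
    "\<And>x. x \<in> topspace X \<Longrightarrow> continuous_map (subtopology X (W x)) (grassmannian_topology m l) g"
    by metis
  show ?thesis
    by (rule pasting_lemma[of "topspace X" X W _ "\<lambda>_. g"]) (use W in auto)
qed

text \<open>
  A local section over \<open>U\<close> of the principal bundle of orthonormal frames.
\<close>
definition grassmannian_section :: "nat \<Rightarrow> nat \<Rightarrow> quat vec set set \<Rightarrow> (quat vec set \<Rightarrow> quat mat) \<Rightarrow> bool" where
  "grassmannian_section m l U \<sigma> \<longleftrightarrow> openin (grassmannian_topology m l) U \<and>
     continuous_map (subtopology (grassmannian_topology m l) U) (mat_topology m l) \<sigma> \<and>
     (\<forall>S\<in>U. \<sigma> S \<in> stiefel m l \<and> column_space (\<sigma> S) = S)"

lemma ex_grassmannian_section: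
  assumes "S0 \<in> grassmannian m l"
  shows "\<exists>U \<sigma>. grassmannian_section m l U \<sigma> \<and> S0 \<in> U"
proof -
  obtain V f where V: "openin (mat_topology m m) V" "orth_proj m S0 \<in> V"
    and f: "continuous_map (subtopology (mat_topology m m) V) (mat_topology m l) f"
    and fV: "\<And>S. S \<in> grassmannian m l \<Longrightarrow> orth_proj m S \<in> V \<Longrightarrow>
       f (orth_proj m S) \<in> stiefel m l \<and> column_space (f (orth_proj m S)) = S"
    using local_frames_of_subspaces[OF assms] by blast
  define U where "U = {S \<in> topspace (grassmannian_topology m l). orth_proj m S \<in> V}"
  have "openin (grassmannian_topology m l) U"
    unfolding U_def by (rule openin_continuous_map_preimage[OF continuous_map_orth_proj V(1)])
  moreover have "continuous_map (subtopology (grassmannian_topology m l) U)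
      (subtopology (mat_topology m m) V) (orth_proj m)"
    using continuous_map_from_subtopology[OF continuous_map_orth_proj]
    by (auto simp: continuous_map_in_subtopology U_def)
  from continuous_map_compose[OF this f]
  have "continuous_map (subtopology (grassmannian_topology m l) U) (mat_topology m l) (f \<circ> orth_proj m)" .
  ultimately have "grassmannian_section m l U (f \<circ> orth_proj m)"
    using fV by (auto simp: grassmannian_section_def U_def)
  moreover have "S0 \<in> U"
    using assms V(2) by (simp add: U_def)
  ultimately show ?thesis by blast
qed

section \<open>Block matrices\<close>

definition upper_block :: "nat \<Rightarrow> nat \<Rightarrow> quat mat \<Rightarrow> quat mat" where
  "upper_block n k x = mat (n - k) k (\<lambda>ij. x $$ ij)"

lemma dim_blocks [simp]:
  "dim_row (upper_block n k x) = n - k" "dim_col (upper_block n k x) = k"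
  "dim_row (lower_block n k x) = k" "dim_col (lower_block n k x) = k"
  by (simp_all add: upper_block_def lower_block_def)

lemma blocks_carrier [simp]:
  "upper_block n k x \<in> carrier_mat (n - k) k" "lower_block n k x \<in> carrier_mat k k"
  by (simp_all add: upper_block_def lower_block_def)

lemma index_blocks [simp]:
  "i < n - k \<Longrightarrow> j < k \<Longrightarrow> upper_block n k x $$ (i, j) = x $$ (i, j)"
  "i < k \<Longrightarrow> j < k \<Longrightarrow> lower_block n k x $$ (i, j) = x $$ (n - k + i, j)"
  by (simp_all add: upper_block_def lower_block_def)

lemma height_eq: "height n k x = rtr (mat_adjoint (lower_block n k x) * lower_block n k x)"
  by (simp add: height_def rtr_def)

lemma sum_lessThan_add:
  fixes f :: "nat \<Rightarrow> 'a :: comm_monoid_add"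
  shows "(\<Sum>i<a + b. f i) = (\<Sum>i<a. f i) + (\<Sum>i<b. f (a + i))"
  by (induction b) (simp_all add: add.assoc)

lemma rtr_blocks:
  assumes "M \<in> carrier_mat n k" "k \<le> n"
  shows "rtr (mat_adjoint M * M) =
    rtr (mat_adjoint (upper_block n k M) * upper_block n k M) +
    rtr (mat_adjoint (lower_block n k M) * lower_block n k M)"
proof -
  have n: "{..<n} = {..<(n - k) + k}" using assms(2) by simp
  have "rtr (mat_adjoint M * M) = (\<Sum>j<k. \<Sum>i<(n - k) + k. (norm (M $$ (i, j)))\<^sup>2)"
    unfolding n[symmetric] by (rule rtr_adjoint_mult_self[OF assms(1)])
  also have "\<dots> = (\<Sum>j<k. (\<Sum>i<n - k. (norm (M $$ (i, j)))\<^sup>2) + (\<Sum>i<k. (norm (M $$ (n - k + i, j)))\<^sup>2))"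
    unfolding sum_lessThan_add ..
  finally show ?thesis
    unfolding rtr_adjoint_mult_self[OF blocks_carrier(1)] rtr_adjoint_mult_self[OF blocks_carrier(2)]
    by (simp add: sum.distrib)
qed

lemma upper_block_mult:
  assumes "M \<in> carrier_mat n k" "C \<in> carrier_mat k k"
  shows "upper_block n k (M * C) = upper_block n k M * C"
  by (rule eq_matI) (use assms in \<open>auto simp: mult_index simp del: index_mult_mat(1)\<close>)

lemma lower_block_mult:
  assumes "M \<in> carrier_mat n k" "C \<in> carrier_mat k k" "k \<le> n"
  shows "lower_block n k (M * C) = lower_block n k M * C"
  by (rule eq_matI) (use assms in \<open>auto simp: mult_index simp del: index_mult_mat(1)\<close>)

lemma diag_block_pair:
  "diag_block_mat [A, B] =
     four_block_mat A (0\<^sub>m (dim_row A) (dim_col B)) (0\<^sub>m (dim_row B) (dim_col A)) B"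
  by (metis diag_block_mat.simps(2) diag_block_mat_singleton)

declare diag_block_mat.simps(2) [simp del]

lemma dim_diag_pair [simp]:
  "dim_row (diag_block_mat [A, B]) = dim_row A + dim_row B"
  "dim_col (diag_block_mat [A, B]) = dim_col A + dim_col B"
  by (simp_all add: dim_diag_block_mat)

lemma index_diag_pair:
  "i < dim_row A + dim_row B \<Longrightarrow> j < dim_col A + dim_col B \<Longrightarrow>
   diag_block_mat [A, B] $$ (i, j) =
     (if i < dim_row A then if j < dim_col A then A $$ (i, j) else 0
      else if j < dim_col A then 0 else B $$ (i - dim_row A, j - dim_col A))"
  unfolding diag_block_pair by (subst index_mat_four_block(1)) auto

lemma diag_pair_mult:
  fixes A B A' B' :: "quat mat"
  assumes "dim_col A = dim_row A'" "dim_col B = dim_row B'"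
  shows "diag_block_mat [A, B] * diag_block_mat [A', B'] = diag_block_mat [A * A', B * B']"
proof -
  have "diag_block_mat [A, B] * diag_block_mat [A', B'] = four_block_mat
      (A * A' + 0\<^sub>m (dim_row A) (dim_col B) * 0\<^sub>m (dim_row B') (dim_col A'))
      (A * 0\<^sub>m (dim_row A') (dim_col B') + 0\<^sub>m (dim_row A) (dim_col B) * B')
      (0\<^sub>m (dim_row B) (dim_col A) * A' + B * 0\<^sub>m (dim_row B') (dim_col A'))
      (0\<^sub>m (dim_row B) (dim_col A) * 0\<^sub>m (dim_row A') (dim_col B') + B * B')"
    unfolding diag_block_pair using assms
    by (intro mult_four_block_mat[where ?nr1.0 = "dim_row A" and ?n1.0 = "dim_col A"
          and ?n2.0 = "dim_col B" and ?nr2.0 = "dim_row B" and ?nc1.0 = "dim_col A'" and ?nc2.0 = "dim_col B'"])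
      (auto intro: carrier_matI)
  also have "\<dots> = diag_block_mat [A * A', B * B']"
    unfolding diag_block_pair using assms by (intro cong_four_block_mat) (auto intro!: eq_matI)
  finally show ?thesis .
qed

lemma diag_pair_adjoint:
  "mat_adjoint (diag_block_mat [A, B]) = diag_block_mat [mat_adjoint A, mat_adjoint B]"
  by (rule eq_matI) (auto simp: index_diag_pair)

lemma diag_pair_one: "diag_block_mat [1\<^sub>m a, 1\<^sub>m b] = (1\<^sub>m (a + b) :: quat mat)"
  by (simp add: diag_block_pair)

lemma diag_pair_inject:
  assumes "diag_block_mat [A, B] = diag_block_mat [A', B']"
    and "dim_row A = dim_row A'" "dim_col A = dim_col A'" "dim_row B = dim_row B'" "dim_col B = dim_col B'"
  shows "A = A' \<and> B = B'"
proof
  show "A = A'"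
  proof (rule eq_matI)
    fix i j assume "i < dim_row A'" "j < dim_col A'"
    then show "A $$ (i, j) = A' $$ (i, j)"
      using arg_cong[OF assms(1), of "\<lambda>M. M $$ (i, j)"] assms(2-5) by (simp add: index_diag_pair)
  qed (use assms in auto)
  show "B = B'"
  proof (rule eq_matI)
    fix i j assume "i < dim_row B'" "j < dim_col B'"
    then show "B $$ (i, j) = B' $$ (i, j)"
      using arg_cong[OF assms(1), of "\<lambda>M. M $$ (dim_row A + i, dim_col A + j)"] assms(2-5)
      by (simp add: index_diag_pair)
  qed (use assms in auto)
qed

lemma diag_pair_stiefel:
  assumes "Y \<in> stiefel a l" "Z \<in> stiefel b q"
  shows "diag_block_mat [Y, Z] \<in> stiefel (a + b) (l + q)"
  using stiefelD[OF assms(1)] stiefelD[OF assms(2)]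
  by (auto simp: stiefel_def diag_pair_adjoint diag_pair_mult diag_pair_one intro!: carrier_matI)

lemma rtr_diag_pair:
  assumes "A \<in> carrier_mat a a" "B \<in> carrier_mat b b"
  shows "rtr (diag_block_mat [A, B]) = rtr A + rtr B"
proof -
  have d: "dim_row A = a" "dim_col A = a" "dim_row B = b" "dim_col B = b" using assms by auto
  show ?thesis
    by (simp add: rtr_eq d sum_lessThan_add index_diag_pair)
qed

lemma blocks_diag_mult:
  assumes x: "x \<in> carrier_mat n k" "k \<le> n" and A: "A \<in> carrier_mat (n - k) (n - k)" "B \<in> carrier_mat k k"
  shows "upper_block n k (diag_block_mat [A, B] * x) = A * upper_block n k x"
    "lower_block n k (diag_block_mat [A, B] * x) = B * lower_block n k x"
proof -
  define a where "a = n - k"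
  have nk: "n - k = a" and n: "n = a + k" using x(2) by (auto simp: a_def)
  have d: "dim_row A = a" "dim_col A = a" "dim_row B = k" "dim_col B = k"
    "dim_row x = n" "dim_col x = k"
    using x A nk by auto
  have *: "(diag_block_mat [A, B] * x) $$ (i, j) =
      (\<Sum>l<a. diag_block_mat [A, B] $$ (i, l) * x $$ (l, j)) +
      (\<Sum>l<k. diag_block_mat [A, B] $$ (i, a + l) * x $$ (a + l, j))" if "i < n" "j < k" for i j
  proof -
    have "(diag_block_mat [A, B] * x) $$ (i, j) = (\<Sum>l<n. diag_block_mat [A, B] $$ (i, l) * x $$ (l, j))"
      using that d n by (subst mult_index) (auto)
    also have "\<dots> = (\<Sum>l<a + k. diag_block_mat [A, B] $$ (i, l) * x $$ (l, j))"
      by (simp only: n[symmetric])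
    finally show ?thesis
      unfolding sum_lessThan_add .
  qed
  show "upper_block n k (diag_block_mat [A, B] * x) = A * upper_block n k x"
  proof (rule eq_matI)
    fix i j assume "i < dim_row (A * upper_block n k x)" "j < dim_col (A * upper_block n k x)"
    then have ij: "i < a" "j < k" using d nk by auto
    then have "upper_block n k (diag_block_mat [A, B] * x) $$ (i, j) = (\<Sum>l<a. A $$ (i, l) * x $$ (l, j))"
      using d nk n by (simp add: * index_diag_pair del: index_mult_mat(1))
    then show "upper_block n k (diag_block_mat [A, B] * x) $$ (i, j) = (A * upper_block n k x) $$ (i, j)"
      using ij d nk by (simp add: mult_index del: index_mult_mat(1))
  qed (use d nk in auto)
  show "lower_block n k (diag_block_mat [A, B] * x) = B * lower_block n k x"
  proof (rule eq_matI)
    fix i j assume "i < dim_row (B * lower_block n k x)" "j < dim_col (B * lower_block n k x)"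
    then have ij: "i < k" "j < k" using d by auto
    then have "lower_block n k (diag_block_mat [A, B] * x) $$ (i, j)
        = (\<Sum>l<k. B $$ (i, l) * x $$ (a + l, j))"
      using d nk n by (simp add: * index_diag_pair del: index_mult_mat(1))
    then show "lower_block n k (diag_block_mat [A, B] * x) $$ (i, j) = (B * lower_block n k x) $$ (i, j)"
      using ij d nk by (simp add: mult_index del: index_mult_mat(1))
  qed (use d nk in auto)
qed

text \<open>
  The relations between the blocks \<open>T\<close> and \<open>P\<close> are those between the blocks of \<open>x x\<^sup>*\<close>.  The
  fourth block \<open>P T\<^sup>*\<close> is the adjoint of \<open>T P\<^sup>*\<close>.
\<close>
lemma outer_gram_eq_diag_iff:
  assumes x: "x \<in> carrier_mat n k" "k \<le> n" and A: "A \<in> carrier_mat (n - k) (n - k)" "B \<in> carrier_mat k k"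
  shows "x * mat_adjoint x = diag_block_mat [A, B] \<longleftrightarrow>
    upper_block n k x * mat_adjoint (lower_block n k x) = 0\<^sub>m (n - k) k \<and>
    upper_block n k x * mat_adjoint (upper_block n k x) = A \<and>
    lower_block n k x * mat_adjoint (lower_block n k x) = B"
proof -
  have d: "dim_row A = n - k" "dim_col A = n - k" "dim_row B = k" "dim_col B = k"
    "dim_row x = n" "dim_col x = k"
    using x A by auto
  let ?T = "upper_block n k x" and ?P = "lower_block n k x"
  define g where "g i j = (\<Sum>l<k. x $$ (i, l) * qcnj (x $$ (j, l)))" for i j
  have xx: "(x * mat_adjoint x) $$ (i, j) = g i j" if "i < n" "j < n" for i j
    using that d by (simp add: mult_index g_def del: index_mult_mat(1))
  have TT: "(?T * mat_adjoint ?T) $$ (i, j) = g i j" if "i < n - k" "j < n - k" for i j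
    using that by (simp add: mult_index g_def del: index_mult_mat(1))
  have TP: "(?T * mat_adjoint ?P) $$ (i, j) = g i (n - k + j)" if "i < n - k" "j < k" for i j
    using that by (simp add: mult_index g_def del: index_mult_mat(1))
  have PP: "(?P * mat_adjoint ?P) $$ (i, j) = g (n - k + i) (n - k + j)" if "i < k" "j < k" for i j
    using that by (simp add: mult_index g_def del: index_mult_mat(1))
  have gc: "g i j = qcnj (g j i)" for i j
    by (simp add: g_def qcnj_sum)
  show ?thesis
  proof (intro iffI conjI)
    assume e: "x * mat_adjoint x = diag_block_mat [A, B]"
    have g: "g i j = diag_block_mat [A, B] $$ (i, j)" if "i < n" "j < n" for i j
      using xx[OF that] by (simp add: e)
    show "?T * mat_adjoint ?P = 0\<^sub>m (n - k) k"
      by (rule eq_matI) (use d x(2) in \<open>auto simp: TP g index_diag_pair simp del: index_mult_mat(1)\<close>)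
    show "?T * mat_adjoint ?T = A"
      by (rule eq_matI) (use d x(2) in \<open>auto simp: TT g index_diag_pair simp del: index_mult_mat(1)\<close>)
    show "?P * mat_adjoint ?P = B"
      by (rule eq_matI) (use d x(2) in \<open>auto simp: PP g index_diag_pair simp del: index_mult_mat(1)\<close>)
  next
    assume a: "?T * mat_adjoint ?P = 0\<^sub>m (n - k) k \<and> ?T * mat_adjoint ?T = A \<and> ?P * mat_adjoint ?P = B"
    have TP0: "g i (n - k + j) = 0" if "i < n - k" "j < k" for i j
      using TP[OF that] a that by simp
    have PT0: "g (n - k + j) i = 0" if "i < n - k" "j < k" for i j
      using TP0[OF that] gc[of "n - k + j" i] by simp
    have TTA: "g i j = A $$ (i, j)" if "i < n - k" "j < n - k" for i j
      using TT[OF that] a by simp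
    have PPB: "g (n - k + i) (n - k + j) = B $$ (i, j)" if "i < k" "j < k" for i j
      using PP[OF that] a by simp
    show "x * mat_adjoint x = diag_block_mat [A, B]"
    proof (rule eq_matI)
      fix i j assume "i < dim_row (diag_block_mat [A, B])" "j < dim_col (diag_block_mat [A, B])"
      then have ij: "i < n" "j < n" using d x(2) by auto
      have "g i j = diag_block_mat [A, B] $$ (i, j)"
        using ij d x(2) TTA[of i j] TP0[of i "j - (n - k)"] PT0[of j "i - (n - k)"]
          PPB[of "i - (n - k)" "j - (n - k)"]
        by (auto simp: index_diag_pair not_less)
      then show "(x * mat_adjoint x) $$ (i, j) = diag_block_mat [A, B] $$ (i, j)"
        by (simp add: xx[OF ij])
    qed (use d x(2) in auto)
  qed
qed

section \<open>Critical points of the height function\<close>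

text \<open>
  If \<open>T P\<^sup>* = 0\<close>, then \<open>x x\<^sup>* = diag(T T\<^sup>*, P P\<^sup>*)\<close>, so that \<open>x = x (x\<^sup>* x) = (x x\<^sup>*) x\<close> splits into
  \<open>T = T T\<^sup>* T\<close> and \<open>P = P P\<^sup>* P\<close>.  The traces of both sides give the relation between the ranks.
\<close>
lemma orthogonal_blocks_partial_isometries:
  assumes x: "x \<in> stiefel n k" and k: "k \<le> n"
    and TP: "upper_block n k x * mat_adjoint (lower_block n k x) = 0\<^sub>m (n - k) k"
  shows "upper_block n k x * (mat_adjoint (upper_block n k x) * upper_block n k x) = upper_block n k x"
    "lower_block n k x * (mat_adjoint (lower_block n k x) * lower_block n k x) = lower_block n k x"
    "rtr (upper_block n k x * mat_adjoint (upper_block n k x)) + height n k x = real k"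
proof -
  let ?T = "upper_block n k x" and ?P = "lower_block n k x"
  note d = stiefelD[OF x]
  have e: "x * mat_adjoint x = diag_block_mat [?T * mat_adjoint ?T, ?P * mat_adjoint ?P]"
    by (subst outer_gram_eq_diag_iff[OF d(1) k]) (auto simp: TP)
  have xe: "diag_block_mat [?T * mat_adjoint ?T, ?P * mat_adjoint ?P] * x = x"
    unfolding e[symmetric] using d(2,3,5) by (simp add: mat_assoc)
  have c: "?T * mat_adjoint ?T \<in> carrier_mat (n - k) (n - k)" "?P * mat_adjoint ?P \<in> carrier_mat k k"
    by (auto intro!: carrier_matI)
  note xb = blocks_diag_mult[OF d(1) k c, unfolded xe]
  show "?T * (mat_adjoint ?T * ?T) = ?T"
    using xb(1)[symmetric] by (simp add: mat_assoc)
  show "?P * (mat_adjoint ?P * ?P) = ?P"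
    using xb(2)[symmetric] by (simp add: mat_assoc)
  have "rtr (?T * mat_adjoint ?T) + rtr (?P * mat_adjoint ?P) = real k"
    using d(7) unfolding e by (subst (asm) rtr_diag_pair[of _ "n - k" _ k]) auto
  moreover have "rtr (?P * mat_adjoint ?P) = height n k x"
    unfolding height_eq by (rule rtr_mult_commute[of _ k k]) auto
  ultimately show "rtr (?T * mat_adjoint ?T) + height n k x = real k"
    by simp
qed

lemma rtr_mult_proj:
  assumes E: "is_proj k E" and A: "A \<in> carrier_mat r k"
  shows "rtr (mat_adjoint (A * E) * (A * E)) = rtr (mat_adjoint A * A * E)"
proof -
  have d: "dim_row E = k" "dim_col E = k" "dim_col A = k" "dim_row A = r" using E A by (auto simp: is_proj_def)
  have "mat_adjoint (A * E) * (A * E) = E * (mat_adjoint A * A * E)"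
    using d E by (simp add: mat_adjoint_mult mat_assoc is_proj_def)
  moreover have "rtr (E * (mat_adjoint A * A * E)) = rtr ((mat_adjoint A * A * E) * E)"
    using d by (intro rtr_mult_commute[of _ k k]) (auto intro!: carrier_matI)
  moreover have "(mat_adjoint A * A * E) * E = mat_adjoint A * A * E"
    using d E by (simp add: mat_assoc is_proj_def)
  ultimately show ?thesis by simp
qed

lemma norm_square_derivative_zero:
  fixes a :: "real \<Rightarrow> quat"
  assumes "a differentiable (at t)" "a t = 0"
  shows "((\<lambda>s. (norm (a s))\<^sup>2) has_real_derivative 0) (at t)"
proof -
  obtain a' where a': "(a has_derivative a') (at t)"
    using assms(1) by (auto simp: differentiable_def)
  have "((\<lambda>s. a s \<bullet> a s) has_derivative (\<lambda>h. a t \<bullet> a' h + a' h \<bullet> a t)) (at t)"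
    by (rule has_derivative_inner[OF a' a'])
  moreover have "(\<lambda>h. a t \<bullet> a' h + a' h \<bullet> a t) = (*) 0"
    by (auto simp: assms(2))
  ultimately show ?thesis
    by (simp add: has_field_derivative_def power2_norm_eq_inner)
qed

lemma rtr_derivative_zero:
  fixes M :: "real \<Rightarrow> quat mat"
  assumes M: "\<And>s. M s \<in> carrier_mat r c" "M t = 0\<^sub>m r c"
    and diff: "\<And>i j. i < r \<Longrightarrow> j < c \<Longrightarrow> (\<lambda>s. M s $$ (i, j)) differentiable (at t)"
  shows "((\<lambda>s. rtr (mat_adjoint (M s) * M s)) has_real_derivative 0) (at t)"
proof -
  have "((\<lambda>s. \<Sum>j<c. \<Sum>i<r. (norm (M s $$ (i, j)))\<^sup>2) has_real_derivative (\<Sum>j<c. \<Sum>i<r. 0)) (at t)"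
    using M(2) by (intro DERIV_sum norm_square_derivative_zero diff) auto
  then show ?thesis
    unfolding rtr_adjoint_mult_self[OF M(1)] by simp
qed

lemma differentiable_mult_const_mat:
  fixes M :: "real \<Rightarrow> quat mat"
  assumes M: "\<And>s. M s \<in> carrier_mat r m" and C: "C \<in> carrier_mat m c"
    and diff: "\<And>i j. i < r \<Longrightarrow> j < m \<Longrightarrow> (\<lambda>s. M s $$ (i, j)) differentiable (at t)"
    and ij: "i < r" "j < c"
  shows "(\<lambda>s. (M s * C) $$ (i, j)) differentiable (at t)"
proof -
  have "(\<lambda>s. (M s * C) $$ (i, j)) = (\<lambda>s. \<Sum>l<m. M s $$ (i, l) * C $$ (l, j))"
    using ij by (simp add: mult_index carrier_matD[OF M] carrier_matD[OF C] del: index_mult_mat(1))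
  moreover have "(\<lambda>s. \<Sum>l<m. M s $$ (i, l) * C $$ (l, j)) differentiable (at t)"
    using ij by (intro differentiable_sum) (auto intro!: differentiable_mult diff)
  ultimately show ?thesis by simp
qed

text \<open>
  Let \<open>E = P\<^sup>* P\<close> at the given point and \<open>F = 1 - E\<close>; these are projections.  Along a curve \<open>T(t)\<close>,
  \<open>P(t)\<close> in the Stiefel manifold the squared norms of \<open>T(t) E\<close> and \<open>P(t) E\<close> add up to
  \<open>tr E\<close>, so the height is \<open>tr E\<close> minus the squared norm of \<open>T(t) E\<close> plus that of \<open>P(t) F\<close>.  Both
  products vanish at \<open>t = 0\<close>, hence their squared norms have derivative zero there.
\<close>
lemma orthogonal_blocks_imp_critical:
  assumes x: "x \<in> stiefel n k" and k: "k \<le> n"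
    and TP: "upper_block n k x * mat_adjoint (lower_block n k x) = 0\<^sub>m (n - k) k"
  shows "x \<in> critical_points n k (height n k)"
  unfolding critical_points_def
proof (intro CollectI conjI x allI impI)
  fix \<gamma> assume "stiefel_curve n k \<gamma> \<and> \<gamma> 0 = x"
  then have \<gamma>: "\<And>t. \<gamma> t \<in> stiefel n k" "\<gamma> 0 = x"
    and diff: "\<And>i j t. i < n \<Longrightarrow> j < k \<Longrightarrow> (\<lambda>s. \<gamma> s $$ (i, j)) differentiable (at t)"
    by (auto simp: stiefel_curve_def)
  define T where "T t = upper_block n k (\<gamma> t)" for t
  define P where "P t = lower_block n k (\<gamma> t)" for t
  define E where "E = mat_adjoint (P 0) * P 0"
  define F where "F = 1\<^sub>m k - E"
  have cT: "T t \<in> carrier_mat (n - k) k" and cP: "P t \<in> carrier_mat k k" for t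
    by (simp_all add: T_def P_def)
  have dims: "dim_row (T t) = n - k" "dim_col (T t) = k" "dim_row (P t) = k" "dim_col (P t) = k" for t
    by (simp_all add: T_def P_def)
  have PE: "P 0 * E = P 0"
    unfolding E_def P_def \<gamma>(2) by (rule orthogonal_blocks_partial_isometries(2)[OF x k TP])
  have E: "is_proj k E"
    using partial_isometry_proj[of "mat_adjoint (P 0)" k k] arg_cong[OF PE, of mat_adjoint] dims
    by (simp add: E_def mat_adjoint_mult mat_assoc cP)
  have cE: "E \<in> carrier_mat k k" using E by (simp add: is_proj_def)
  have F: "is_proj k F"
    unfolding F_def by (rule proj_diff[OF proj_one E]) (use cE in auto)
  have cF: "F \<in> carrier_mat k k" using F by (simp add: is_proj_def)
  have TE: "T 0 * E = 0\<^sub>m (n - k) k"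
  proof -
    have "T 0 * E = (T 0 * mat_adjoint (P 0)) * P 0"
      unfolding E_def using dims by (simp add: mat_assoc)
    also have "T 0 * mat_adjoint (P 0) = 0\<^sub>m (n - k) k"
      using TP by (simp add: T_def P_def \<gamma>(2))
    finally show ?thesis using dims by simp
  qed
  have PF: "P 0 * F = 0\<^sub>m k k"
  proof -
    have "P 0 * F = P 0 * 1\<^sub>m k - P 0 * E"
      unfolding F_def by (rule mult_minus_distrib_mat[OF cP one_carrier_mat cE])
    then show ?thesis
      using cP[of 0] by (simp add: PE right_mult_one_mat[OF cP])
  qed
  have h: "height n k (\<gamma> t) =
      rtr E - rtr (mat_adjoint (T t * E) * (T t * E)) + rtr (mat_adjoint (P t * F) * (P t * F))" for t
  proof -
    note d = stiefelD[OF \<gamma>(1)[of t]]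
    have "rtr (mat_adjoint (\<gamma> t * E) * (\<gamma> t * E)) = rtr E"
      unfolding rtr_mult_proj[OF E d(1)] d(4) using cE by simp
    then have 1: "rtr (mat_adjoint (T t * E) * (T t * E)) + rtr (mat_adjoint (P t * E) * (P t * E)) = rtr E"
      using rtr_blocks[of "\<gamma> t * E" n k] d(1) cE k
      by (simp add: upper_block_mult lower_block_mult T_def P_def)
    have "mat_adjoint (P t) * P t * F = mat_adjoint (P t) * P t * 1\<^sub>m k - mat_adjoint (P t) * P t * E"
      unfolding F_def using dims by (intro mult_minus_distrib_mat[OF _ one_carrier_mat cE, of _ k]) auto
    then have "mat_adjoint (P t) * P t * F = mat_adjoint (P t) * P t - mat_adjoint (P t) * P t * E"
      using dims by simp
    moreover have "mat_adjoint (P t) * P t \<in> carrier_mat k k" "mat_adjoint (P t) * P t * E \<in> carrier_mat k k"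
      using cE by (auto intro!: carrier_matI simp: dims)
    ultimately have "rtr (mat_adjoint (P t) * P t * F) = rtr (mat_adjoint (P t) * P t) - rtr (mat_adjoint (P t) * P t * E)"
      by (simp only: rtr_minus)
    then have "rtr (mat_adjoint (P t) * P t) =
        rtr (mat_adjoint (P t * E) * (P t * E)) + rtr (mat_adjoint (P t * F) * (P t * F))"
      unfolding rtr_mult_proj[OF E cP] rtr_mult_proj[OF F cP] by simp
    then show ?thesis
      using 1 by (simp add: height_eq P_def)
  qed
  have "((\<lambda>t. rtr (mat_adjoint (T t * E) * (T t * E))) has_real_derivative 0) (at 0)"
  proof (rule rtr_derivative_zero[where M = "\<lambda>t. T t * E", OF _ TE])
    show "T s * E \<in> carrier_mat (n - k) k" for s
      using cT cE by (rule mult_carrier_mat)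
    fix i j assume "i < n - k" "j < k"
    then show "(\<lambda>s. (T s * E) $$ (i, j)) differentiable (at 0)"
      by (intro differentiable_mult_const_mat[OF cT cE]) (auto simp: T_def intro: diff)
  qed
  moreover have "((\<lambda>t. rtr (mat_adjoint (P t * F) * (P t * F))) has_real_derivative 0) (at 0)"
  proof (rule rtr_derivative_zero[where M = "\<lambda>t. P t * F", OF _ PF])
    show "P s * F \<in> carrier_mat k k" for s
      using cP cF by (rule mult_carrier_mat)
    fix i j assume "i < k" "j < k"
    then show "(\<lambda>s. (P s * F) $$ (i, j)) differentiable (at 0)"
      using k by (intro differentiable_mult_const_mat[OF cP cF]) (auto simp: P_def intro: diff)
  qed
  ultimately show "((\<lambda>t. height n k (\<gamma> t)) has_real_derivative 0) (at 0)"
    unfolding h by (auto intro!: derivative_eq_intros)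
qed

text \<open>
  The orbit of \<open>x\<close> under the one-parameter group of unitary matrices that rotates the rows \<open>i\<close> and
  \<open>j\<close> into each other, twisted by the unit quaternion \<open>u\<close>.
\<close>
definition row_rotation :: "nat \<Rightarrow> nat \<Rightarrow> quat \<Rightarrow> quat mat \<Rightarrow> real \<Rightarrow> quat mat" where
  "row_rotation i j u x t = mat (dim_row x) (dim_col x) (\<lambda>(r, s).
     if r = i then cos t *\<^sub>R x $$ (i, s) + sin t *\<^sub>R (u * x $$ (j, s))
     else if r = j then cos t *\<^sub>R x $$ (j, s) - sin t *\<^sub>R (qcnj u * x $$ (i, s))
     else x $$ (r, s))"

lemma rotation_preserves_hermitian_form:
  assumes u: "norm (u :: quat) = 1" and c: "c\<^sup>2 + d\<^sup>2 = (1 :: real)"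
  shows "qcnj (c *\<^sub>R a + d *\<^sub>R (u * b)) * (c *\<^sub>R a' + d *\<^sub>R (u * b')) +
     qcnj (c *\<^sub>R b - d *\<^sub>R (qcnj u * a)) * (c *\<^sub>R b' - d *\<^sub>R (qcnj u * a')) =
     qcnj a * a' + qcnj b * b'"
proof -
  have u1: "qcnj u * u = 1"
    using qcnj_mult_self[of u] u by simp
  have u2: "u * qcnj u = 1"
    using qcnj_mult_self[of "qcnj u"] u by simp
  have 1: "qcnj b * qcnj u * (u * b') = qcnj b * b'"
    by (metis u1 mult.assoc mult.left_neutral)
  have 2: "qcnj a * u * (qcnj u * a') = qcnj a * a'"
    by (metis u2 mult.assoc mult.left_neutral)
  have "qcnj (c *\<^sub>R a + d *\<^sub>R (u * b)) * (c *\<^sub>R a' + d *\<^sub>R (u * b')) +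
     qcnj (c *\<^sub>R b - d *\<^sub>R (qcnj u * a)) * (c *\<^sub>R b' - d *\<^sub>R (qcnj u * a')) =
     (c * c) *\<^sub>R (qcnj a * a' + qcnj b * b') +
     (d * d) *\<^sub>R (qcnj b * qcnj u * (u * b') + qcnj a * u * (qcnj u * a'))"
    by (simp add: distrib_left distrib_right left_diff_distrib right_diff_distrib
        scaleR_add_right scaleR_diff_right mult.assoc mult.commute[of d c])
  also have "\<dots> = (c\<^sup>2 + d\<^sup>2) *\<^sub>R (qcnj a * a' + qcnj b * b')"
    unfolding 1 2 by (simp add: scaleR_add_left scaleR_add_right power2_eq_square)
  finally show ?thesis by (simp add: c)
qed

lemma row_rotation_stiefel:
  assumes x: "x \<in> stiefel n k" and ij: "i < n" "j < n" "i \<noteq> j" and u: "norm u = 1"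
  shows "row_rotation i j u x t \<in> stiefel n k"
proof -
  note d = stiefelD[OF x]
  let ?y = "row_rotation i j u x t"
  have dy: "dim_row ?y = n" "dim_col ?y = k"
    by (simp_all add: row_rotation_def d)
  \<comment> \<open>Only the two rotated rows contribute to the change of \<open>x\<^sup>* x\<close>.\<close>
  have split: "(\<Sum>r<n. f r) = (f i + f j) + (\<Sum>r\<in>{..<n} - {i, j}. f r)" for f :: "nat \<Rightarrow> quat"
  proof -
    have "(\<Sum>r<n. f r) = (\<Sum>r\<in>{i, j}. f r) + (\<Sum>r\<in>{..<n} - {i, j}. f r)"
      using ij by (subst sum.subset_diff[of "{i, j}"]) (auto simp: add.commute)
    then show ?thesis using ij by simp
  qed
  have "mat_adjoint ?y * ?y = mat_adjoint x * x"
  proof (rule eq_matI)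
    fix a b assume "a < dim_row (mat_adjoint x * x)" "b < dim_col (mat_adjoint x * x)"
    then have ab: "a < k" "b < k" using d by auto
    have "(mat_adjoint ?y * ?y) $$ (a, b) = (\<Sum>r<n. qcnj (?y $$ (r, a)) * ?y $$ (r, b))"
      using ab dy by (simp add: mult_index del: index_mult_mat(1))
    also have "\<dots> = (\<Sum>r<n. qcnj (x $$ (r, a)) * x $$ (r, b))"
      unfolding split
    proof (rule arg_cong2[where f = "(+)"])
      show "qcnj (?y $$ (i, a)) * ?y $$ (i, b) + qcnj (?y $$ (j, a)) * ?y $$ (j, b) =
          qcnj (x $$ (i, a)) * x $$ (i, b) + qcnj (x $$ (j, a)) * x $$ (j, b)"
        using rotation_preserves_hermitian_form[OF u, of "cos t" "sin t" "x $$ (i, a)" "x $$ (j, a)"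
            "x $$ (i, b)" "x $$ (j, b)"] ab ij d
        by (simp add: row_rotation_def)
      show "(\<Sum>r\<in>{..<n} - {i, j}. qcnj (?y $$ (r, a)) * ?y $$ (r, b)) =
          (\<Sum>r\<in>{..<n} - {i, j}. qcnj (x $$ (r, a)) * x $$ (r, b))"
        using ab d by (intro sum.cong) (auto simp: row_rotation_def)
    qed
    also have "\<dots> = (mat_adjoint x * x) $$ (a, b)"
      using ab d(1-3) by (simp add: mult_index del: index_mult_mat(1))
    finally show "(mat_adjoint ?y * ?y) $$ (a, b) = (mat_adjoint x * x) $$ (a, b)" .
  qed (use d dy in auto)
  then show ?thesis
    using d(4) dy by (auto simp: stiefel_def intro!: carrier_matI)
qed

lemma row_rotation_curve:
  assumes x: "x \<in> stiefel n k" and ij: "i < n" "j < n" "i \<noteq> j" and u: "norm u = 1"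
  shows "stiefel_curve n k (row_rotation i j u x)"
  unfolding stiefel_curve_def
proof (intro conjI allI impI row_rotation_stiefel[OF assms])
  have diff: "(\<lambda>s. cos s *\<^sub>R v + sin s *\<^sub>R w) differentiable (at t)" for v w :: quat and t :: real
    unfolding differentiable_def by (auto intro!: exI derivative_eq_intros)
  note d = stiefelD[OF x]
  fix r s t assume rs: "r < n" "s < k"
  show "(\<lambda>t. row_rotation i j u x t $$ (r, s)) differentiable (at t)"
    using rs d(2,3) diff[of "x $$ (i, s)" "u * x $$ (j, s)"] diff[of "x $$ (j, s)" "- (qcnj u * x $$ (i, s))"]
    by (cases "r = i"; cases "r = j") (simp_all add: row_rotation_def)
qed

text \<open>
  If the entry \<open>c\<close> of \<open>T P\<^sup>*\<close> at \<open>(i, j)\<close> were nonzero, rotating row \<open>i\<close> of \<open>T\<close> into row \<open>j\<close> of \<open>P\<close> with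
  the twist \<open>u = c / |c|\<close> would change the height at speed \<open>- 2 |c|\<close>.
\<close>
lemma critical_imp_orthogonal_blocks:
  assumes crit: "x \<in> critical_points n k (height n k)" and k: "k \<le> n"
  shows "upper_block n k x * mat_adjoint (lower_block n k x) = 0\<^sub>m (n - k) k"
proof (rule eq_matI)
  have x: "x \<in> stiefel n k" using crit by (simp add: critical_points_def)
  note d = stiefelD[OF x]
  fix i j assume "i < dim_row (0\<^sub>m (n - k) k :: quat mat)" "j < dim_col (0\<^sub>m (n - k) k :: quat mat)"
  then have ij: "i < n - k" "j < k" by auto
  define j' where "j' = n - k + j"
  have ij': "i < n" "j' < n" "i \<noteq> j'" using ij k by (auto simp: j'_def)
  define c where "c = (\<Sum>s<k. x $$ (i, s) * qcnj (x $$ (j', s)))"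
  have "c = 0"
  proof (rule ccontr)
    assume "c \<noteq> 0"
    define u where "u = (1 / norm c) *\<^sub>R c"
    have u: "norm u = 1" using \<open>c \<noteq> 0\<close> by (simp add: u_def)
    let ?\<gamma> = "row_rotation i j' u x"
    have "?\<gamma> 0 = x"
      using d by (auto simp: row_rotation_def intro!: eq_matI)
    then have deriv: "((\<lambda>t. height n k (?\<gamma> t)) has_real_derivative 0) (at 0)"
      using crit row_rotation_curve[OF x ij' u] by (auto simp: critical_points_def)
    define a where "a = (\<Sum>s<k. (norm (x $$ (j', s)))\<^sup>2)"
    define b where "b = (\<Sum>s<k. x $$ (j', s) \<bullet> (qcnj u * x $$ (i, s)))"
    define e where "e = (\<Sum>s<k. (norm (x $$ (i, s)))\<^sup>2)"
    \<comment> \<open>The part of the height that comes from the rows of \<open>P\<close> other than \<open>j\<close> is constant.\<close>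
    define K where "K = (\<Sum>s<k. \<Sum>r\<in>{..<k} - {j}. (norm (x $$ (n - k + r, s)))\<^sup>2)"
    have "height n k (?\<gamma> t) = K + ((cos t)\<^sup>2 * a - 2 * cos t * sin t * b + (sin t)\<^sup>2 * e)" for t
    proof -
      have "height n k (?\<gamma> t) = (\<Sum>s<k. \<Sum>r<k. (norm (?\<gamma> t $$ (n - k + r, s)))\<^sup>2)"
        unfolding height_eq rtr_adjoint_mult_self[OF blocks_carrier(2)] by simp
      also have "\<dots> = (\<Sum>s<k. (norm (?\<gamma> t $$ (n - k + j, s)))\<^sup>2 +
          (\<Sum>r\<in>{..<k} - {j}. (norm (?\<gamma> t $$ (n - k + r, s)))\<^sup>2))"
        using ij by (intro sum.cong refl sum.remove) auto
      also have "\<dots> = (\<Sum>s<k. ((cos t)\<^sup>2 * (norm (x $$ (j', s)))\<^sup>2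
            - 2 * cos t * sin t * (x $$ (j', s) \<bullet> (qcnj u * x $$ (i, s)))
            + (sin t)\<^sup>2 * (norm (x $$ (i, s)))\<^sup>2) +
          (\<Sum>r\<in>{..<k} - {j}. (norm (x $$ (n - k + r, s)))\<^sup>2))"
      proof (intro sum.cong refl arg_cong2[where f = "(+)"])
        fix s assume "s \<in> {..<k}"
        then have "?\<gamma> t $$ (n - k + j, s) = cos t *\<^sub>R x $$ (j', s) - sin t *\<^sub>R (qcnj u * x $$ (i, s))"
          using ij' d by (simp add: row_rotation_def flip: j'_def)
        moreover have "(norm (cos t *\<^sub>R v - sin t *\<^sub>R w))\<^sup>2 =
            (cos t)\<^sup>2 * (norm v)\<^sup>2 - 2 * cos t * sin t * (v \<bullet> w) + (sin t)\<^sup>2 * (norm w)\<^sup>2" for v w :: quat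
          unfolding power2_norm_eq_inner
          by (simp add: inner_diff_left inner_diff_right inner_commute[of w v] power2_eq_square algebra_simps)
        ultimately show "(norm (?\<gamma> t $$ (n - k + j, s)))\<^sup>2 = (cos t)\<^sup>2 * (norm (x $$ (j', s)))\<^sup>2
            - 2 * cos t * sin t * (x $$ (j', s) \<bullet> (qcnj u * x $$ (i, s)))
            + (sin t)\<^sup>2 * (norm (x $$ (i, s)))\<^sup>2"
          using u by (simp add: norm_mult)
        fix r assume "r \<in> {..<k} - {j}"
        then show "(norm (?\<gamma> t $$ (n - k + r, s)))\<^sup>2 = (norm (x $$ (n - k + r, s)))\<^sup>2"
          using ij k \<open>s \<in> {..<k}\<close> d by (auto simp: row_rotation_def j'_def)
      qed
      finally show ?thesis
        by (simp add: K_def a_def b_def e_def sum.distrib sum_subtractf sum_distrib_left)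
    qed
    then have "((\<lambda>t. height n k (?\<gamma> t)) has_real_derivative - 2 * b) (at 0)"
      by (auto intro!: derivative_eq_intros)
    with deriv have "b = 0"
      using DERIV_unique by fastforce
    have "b = (\<Sum>s<k. qre (qcnj u * (x $$ (i, s) * qcnj (x $$ (j', s)))))"
      unfolding b_def by (intro sum.cong) (simp_all add: inner_quat_def quat_defs algebra_simps)
    also have "\<dots> = qre (qcnj u * c)"
      by (simp add: c_def sum_distrib_left qre_sum)
    also have "\<dots> = norm c"
      by (simp add: u_def qcnj_mult_self power2_eq_square)
    finally show False
      using \<open>b = 0\<close> \<open>c \<noteq> 0\<close> by simp
  qed
  then show "(upper_block n k x * mat_adjoint (lower_block n k x)) $$ (i, j) = 0\<^sub>m (n - k) k $$ (i, j)"
    using ij by (simp add: mult_index c_def j'_def del: index_mult_mat(1))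
qed auto

section \<open>The critical level as a set of products\<close>

lemma critical_level_iff:
  assumes "k \<le> n"
  shows "x \<in> critical_level n k r \<longleftrightarrow> x \<in> stiefel n k \<and>
    upper_block n k x * mat_adjoint (lower_block n k x) = 0\<^sub>m (n - k) k \<and> height n k x = r"
  using orthogonal_blocks_imp_critical[OF _ assms] critical_imp_orthogonal_blocks[OF _ assms]
  by (auto simp: critical_level_def critical_points_def)

lemma critical_level_stiefel: "x \<in> critical_level n k r \<Longrightarrow> x \<in> stiefel n k"
  by (simp add: critical_level_def critical_points_def)

lemma critical_level_blocks:
  assumes "x \<in> critical_level n k r" "k \<le> n"
  shows "upper_block n k x * (mat_adjoint (upper_block n k x) * upper_block n k x) = upper_block n k x"
    "lower_block n k x * (mat_adjoint (lower_block n k x) * lower_block n k x) = lower_block n k x"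
    "rtr (upper_block n k x * mat_adjoint (upper_block n k x)) = real k - r"
    "rtr (lower_block n k x * mat_adjoint (lower_block n k x)) = r"
    "orth_proj (n - k) (column_space (upper_block n k x)) = upper_block n k x * mat_adjoint (upper_block n k x)"
    "orth_proj k (column_space (lower_block n k x)) = lower_block n k x * mat_adjoint (lower_block n k x)"
    "x * mat_adjoint x = diag_block_mat [upper_block n k x * mat_adjoint (upper_block n k x),
       lower_block n k x * mat_adjoint (lower_block n k x)]"
proof -
  have x: "x \<in> stiefel n k" "upper_block n k x * mat_adjoint (lower_block n k x) = 0\<^sub>m (n - k) k"
    "height n k x = r"
    using assms by (auto simp: critical_level_iff)
  note * = orthogonal_blocks_partial_isometries[OF x(1) assms(2) x(2)]
  show 1: "upper_block n k x * (mat_adjoint (upper_block n k x) * upper_block n k x) = upper_block n k x"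
    and 2: "lower_block n k x * (mat_adjoint (lower_block n k x) * lower_block n k x) = lower_block n k x"
    by (rule *(1), rule *(2))
  show "rtr (upper_block n k x * mat_adjoint (upper_block n k x)) = real k - r"
    using *(3) x(3) by simp
  show "rtr (lower_block n k x * mat_adjoint (lower_block n k x)) = r"
    unfolding x(3)[symmetric] height_eq by (rule rtr_mult_commute[of _ k k]) auto
  show "orth_proj (n - k) (column_space (upper_block n k x)) = upper_block n k x * mat_adjoint (upper_block n k x)"
    by (rule orth_proj_column_space[OF _ 1]) auto
  show "orth_proj k (column_space (lower_block n k x)) = lower_block n k x * mat_adjoint (lower_block n k x)"
    by (rule orth_proj_column_space[OF _ 2]) auto
  show "x * mat_adjoint x = diag_block_mat [upper_block n k x * mat_adjoint (upper_block n k x),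
       lower_block n k x * mat_adjoint (lower_block n k x)]"
    by (subst outer_gram_eq_diag_iff[OF stiefelD(1)[OF x(1)] assms(2)])
      (auto simp: x(2) intro!: carrier_matI)
qed

text \<open>
  The column space has some frame \<open>Y\<close>, and \<open>Y Y\<^sup>* = T T\<^sup>*\<close> because the orthogonal projection onto a
  subspace is unique; the trace then determines the length of \<open>Y\<close>.
\<close>
lemma partial_isometry_column_space_grassmannian:
  assumes T: "T \<in> carrier_mat m c" "T * (mat_adjoint T * T) = T" and r: "rtr (T * mat_adjoint T) = real l"
  shows "column_space T \<in> grassmannian m l"
proof -
  obtain l' Y where Y: "Y \<in> stiefel m l'" "column_space Y = column_space T"
    by (rule quat_subspace_has_frame[OF quat_subspace_column_space[OF T(1)]])
  have "Y * mat_adjoint Y = T * mat_adjoint T"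
    using orth_proj_frame[OF Y(1)] orth_proj_column_space[OF T] by (simp add: Y(2))
  then have "l' = l"
    using stiefelD(7)[OF Y(1)] r by simp
  then show ?thesis
    using Y by (auto simp: grassmannian_iff_frame)
qed

lemma critical_level_le:
  assumes "x \<in> critical_level n k (real q)" "k \<le> n"
  shows "q \<le> k"
proof -
  note * = critical_level_blocks[OF assms]
  have "is_proj (n - k) (upper_block n k x * mat_adjoint (upper_block n k x))"
    by (rule partial_isometry_proj[OF _ *(1)]) auto
  from proj_rtr_nonneg[OF this] show ?thesis
    by (simp add: *(3))
qed

lemma critical_level_column_spaces:
  assumes "x \<in> critical_level n k (real q)" "k \<le> n"
  shows "column_space (upper_block n k x) \<in> grassmannian (n - k) (k - q)"
    "column_space (lower_block n k x) \<in> grassmannian k q"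
  using critical_level_blocks[OF assms] critical_level_le[OF assms]
  by (auto intro!: partial_isometry_column_space_grassmannian[of _ _ k] simp: of_nat_diff)

text \<open>
  Since \<open>C C\<^sup>* = 1\<close>, the product \<open>x = D C\<close> has the same \<open>x x\<^sup>*\<close> as \<open>D = diag(Y, Z)\<close>, and this matrix
  determines the height, the column spaces of the blocks, and whether \<open>T P\<^sup>*\<close> vanishes.
\<close>
lemma diag_frames_mult_in_critical_level:
  assumes Y: "Y \<in> stiefel (n - k) (k - q)" and Z: "Z \<in> stiefel k q" and C: "C \<in> stiefel k k"
    and le: "q \<le> k" "k \<le> n"
  shows "diag_block_mat [Y, Z] * C \<in> critical_level n k (real q)"
    "column_space (upper_block n k (diag_block_mat [Y, Z] * C)) = column_space Y"
    "column_space (lower_block n k (diag_block_mat [Y, Z] * C)) = column_space Z"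
proof -
  let ?D = "diag_block_mat [Y, Z]" and ?x = "diag_block_mat [Y, Z] * C"
  note dY = stiefelD[OF Y] and dZ = stiefelD[OF Z] and dC = stiefelD[OF C]
  have D: "?D \<in> stiefel n k"
    using diag_pair_stiefel[OF Y Z] le by simp
  note dD = stiefelD[OF D]
  have cx: "?x \<in> carrier_mat n k"
    by (rule mult_carrier_mat[OF dD(1) dC(1)])
  have "mat_adjoint ?x * ?x = mat_adjoint C * (mat_adjoint ?D * ?D) * C"
    using dD(1-3) dC(1-3) by (simp add: mat_adjoint_mult mat_assoc del: dim_diag_pair)
  also have "\<dots> = 1\<^sub>m k"
    unfolding dD(4) using dC(1-4) by simp
  finally have x: "?x \<in> stiefel n k"
    using cx by (simp add: stiefel_def)
  have "?x * mat_adjoint ?x = ?D * (C * mat_adjoint C) * mat_adjoint ?D"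
    using dD(1-3) dC(1-3) by (simp add: mat_adjoint_mult mat_assoc del: dim_diag_pair)
  also have "\<dots> = ?D * mat_adjoint ?D"
    unfolding Sp_mult_adjoint[OF C] using dD(2,3) by (simp del: dim_diag_pair)
  also have "\<dots> = diag_block_mat [Y * mat_adjoint Y, Z * mat_adjoint Z]"
    by (simp add: diag_pair_adjoint diag_pair_mult)
  finally have xx: "upper_block n k ?x * mat_adjoint (lower_block n k ?x) = 0\<^sub>m (n - k) k"
    "upper_block n k ?x * mat_adjoint (upper_block n k ?x) = Y * mat_adjoint Y"
    "lower_block n k ?x * mat_adjoint (lower_block n k ?x) = Z * mat_adjoint Z"
    using dY(1-3) dZ(1-3) by (subst (asm) outer_gram_eq_diag_iff[OF cx le(2)]; auto intro!: carrier_matI)+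
  have "height n k ?x = rtr (lower_block n k ?x * mat_adjoint (lower_block n k ?x))"
    unfolding height_eq by (rule rtr_mult_commute[of _ k k]) auto
  also have "\<dots> = real q"
    unfolding xx(3) by (rule dZ(7))
  finally show lev: "?x \<in> critical_level n k (real q)"
    using x xx(1) by (simp add: critical_level_iff[OF le(2)])
  note b = critical_level_blocks[OF lev le(2)]
  show "column_space (upper_block n k ?x) = column_space Y"
    using column_space_partial_isometry[OF blocks_carrier(1) b(1)]
      column_space_partial_isometry[OF dY(1,5)] by (simp add: xx(2))
  show "column_space (lower_block n k ?x) = column_space Z"
    using column_space_partial_isometry[OF blocks_carrier(2) b(2)]
      column_space_partial_isometry[OF dZ(1,5)] by (simp add: xx(3))
qed

text \<open>
  As \<open>Y\<close> and \<open>Z\<close> are frames of the column spaces of the blocks of \<open>x\<close>, the matrix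
  \<open>D = diag(Y, Z)\<close> satisfies \<open>D D\<^sup>* = diag(T T\<^sup>*, P P\<^sup>*) = x x\<^sup>*\<close>.  Therefore \<open>D D\<^sup>* x = x x\<^sup>* x = x\<close>.
\<close>
lemma critical_level_factor:
  assumes x: "x \<in> critical_level n k (real q)" and k: "k \<le> n"
    and Y: "Y \<in> stiefel (n - k) (k - q)" "column_space Y = column_space (upper_block n k x)"
    and Z: "Z \<in> stiefel k q" "column_space Z = column_space (lower_block n k x)"
  shows "diag_block_mat [Y, Z] * (mat_adjoint (diag_block_mat [Y, Z]) * x) = x"
    "mat_adjoint (diag_block_mat [Y, Z]) * x \<in> stiefel k k"
proof -
  let ?D = "diag_block_mat [Y, Z]"
  have D: "?D \<in> stiefel n k"
    using diag_pair_stiefel[OF Y(1) Z(1)] critical_level_le[OF x k] k by simp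
  note dD = stiefelD[OF D] and dx = stiefelD[OF critical_level_stiefel[OF x]]
  note b = critical_level_blocks[OF x k]
  have "?D * mat_adjoint ?D = diag_block_mat [Y * mat_adjoint Y, Z * mat_adjoint Z]"
    by (simp add: diag_pair_adjoint diag_pair_mult)
  also have "\<dots> = x * mat_adjoint x"
    using orth_proj_frame[OF Y(1)] orth_proj_frame[OF Z(1)] b(5-7) by (simp add: Y(2) Z(2))
  finally have DD: "?D * mat_adjoint ?D * x = x"
    using dx(2,3,5) by (simp add: mat_assoc)
  then show DDx: "?D * (mat_adjoint ?D * x) = x"
    using dD(2,3) dx(2,3) by (simp add: mat_assoc del: dim_diag_pair)
  have "mat_adjoint (mat_adjoint ?D * x) * (mat_adjoint ?D * x) = mat_adjoint x * (?D * (mat_adjoint ?D * x))"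
    using dD(2,3) dx(2,3) by (simp add: mat_adjoint_mult mat_assoc del: dim_diag_pair)
  then show "mat_adjoint ?D * x \<in> stiefel k k"
    unfolding DDx using dD(2,3) dx(2-4) by (auto simp: stiefel_def simp del: dim_diag_pair intro!: carrier_matI)
qed

lemma adjoint_diag_mult_cancel:
  assumes Y: "Y \<in> stiefel a l" and Z: "Z \<in> stiefel b q" and C: "C \<in> carrier_mat (l + q) c"
  shows "mat_adjoint (diag_block_mat [Y, Z]) * (diag_block_mat [Y, Z] * C) = C"
proof -
  note dD = stiefelD[OF diag_pair_stiefel[OF Y Z]]
  have "mat_adjoint (diag_block_mat [Y, Z]) * (diag_block_mat [Y, Z] * C) =
      mat_adjoint (diag_block_mat [Y, Z]) * diag_block_mat [Y, Z] * C"
    using dD(2,3) C by (simp add: mat_assoc del: dim_diag_pair)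
  then show ?thesis
    unfolding dD(4) using C by simp
qed

section \<open>The structure group\<close>

lemma continuous_map_Sp_iff:
  "continuous_map X (Sp_topology n) f \<longleftrightarrow>
     continuous_map X (mat_topology n n) f \<and> f \<in> topspace X \<rightarrow> stiefel n n"
  by (simp add: Sp_topology_def carrier_Sp continuous_map_in_subtopology)

lemma topspace_Sp_topology [simp]: "topspace (Sp_topology n) = stiefel n n"
  by (auto simp: Sp_topology_def carrier_Sp stiefel_def)

lemma stiefel_mult:
  assumes "A \<in> stiefel n m" "B \<in> stiefel m l"
  shows "A * B \<in> stiefel n l"
proof -
  note dA = stiefelD[OF assms(1)] and dB = stiefelD[OF assms(2)]
  have "mat_adjoint (A * B) * (A * B) = mat_adjoint B * (mat_adjoint A * A * B)"
    using dA(1-3) dB(1-3) by (simp add: mat_adjoint_mult mat_assoc)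
  also have "\<dots> = 1\<^sub>m l"
    unfolding dA(4) using dB(2-4) by simp
  finally show ?thesis
    using mult_carrier_mat[OF dA(1) dB(1)] by (simp add: stiefel_def)
qed

lemma stiefel_one: "1\<^sub>m n \<in> stiefel n n"
  by (simp add: stiefel_def)

lemma stiefel_adjoint: "A \<in> stiefel n n \<Longrightarrow> mat_adjoint A \<in> stiefel n n"
  using Sp_mult_adjoint[of A n] by (simp add: stiefel_def)

lemma group_Sp: "group (Sp n)"
proof (rule groupI)
  show "\<exists>y\<in>carrier (Sp n). y \<otimes>\<^bsub>Sp n\<^esub> x = \<one>\<^bsub>Sp n\<^esub>" if "x \<in> carrier (Sp n)" for x
    using that stiefel_adjoint[of x n] stiefelD(4)[of x n n] unfolding carrier_Sp by (auto simp: Sp_def)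
  show "x \<otimes>\<^bsub>Sp n\<^esub> y \<otimes>\<^bsub>Sp n\<^esub> z = x \<otimes>\<^bsub>Sp n\<^esub> (y \<otimes>\<^bsub>Sp n\<^esub> z)"
    if "x \<in> carrier (Sp n)" "y \<in> carrier (Sp n)" "z \<in> carrier (Sp n)" for x y z
    using that by (auto simp: Sp_def intro!: mat_assoc)
qed (auto simp: carrier_Sp stiefel_mult stiefel_one, auto simp: Sp_def stiefel_mult stiefel_one dest: stiefelD(2))

lemma inv_Sp: "A \<in> carrier (Sp n) \<Longrightarrow> inv\<^bsub>Sp n\<^esub> A = mat_adjoint A"
  using stiefel_adjoint[of A n] stiefelD(4)[of A n n]
  by (intro group.inv_equality[OF group_Sp]) (auto simp: carrier_Sp, auto simp: Sp_def)

lemma topological_group_Sp: "topological_group (Sp n) (Sp_topology n)"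
  unfolding topological_group_def
proof (intro conjI group_Sp)
  show "topspace (Sp_topology n) = carrier (Sp n)" by (simp add: carrier_Sp)
  have id: "continuous_map (Sp_topology n) (mat_topology n n) (\<lambda>a. a)"
    by (simp add: Sp_topology_def continuous_map_from_subtopology)
  have "continuous_map (prod_topology (Sp_topology n) (Sp_topology n)) (mat_topology n n) (\<lambda>p. fst p * snd p)"
    using continuous_map_compose[OF continuous_map_fst id] continuous_map_compose[OF continuous_map_snd id]
    by (intro continuous_map_mat_mult[where m = n]) (auto simp: o_def)
  then show "continuous_map (prod_topology (Sp_topology n) (Sp_topology n)) (Sp_topology n)
      (\<lambda>(a, b). a \<otimes>\<^bsub>Sp n\<^esub> b)"
    by (auto simp: continuous_map_Sp_iff Sp_def case_prod_unfold stiefel_mult)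
  have "continuous_map (Sp_topology n) (Sp_topology n) mat_adjoint"
    using continuous_map_mat_adjoint[OF id] by (auto simp: continuous_map_Sp_iff stiefel_adjoint)
  then show "continuous_map (Sp_topology n) (Sp_topology n) (\<lambda>a. inv\<^bsub>Sp n\<^esub> a)"
    by (rule continuous_map_eq) (simp add: inv_Sp carrier_Sp)
qed

lemma topological_group_DirProd:
  assumes G: "topological_group G S" and H: "topological_group H T"
  shows "topological_group (G \<times>\<times> H) (prod_topology S T)"
  unfolding topological_group_def
proof (intro conjI)
  have g: "group G" "group H" and c: "topspace S = carrier G" "topspace T = carrier H"
    and mG: "continuous_map (prod_topology S S) S (\<lambda>(a, b). a \<otimes>\<^bsub>G\<^esub> b)"
    and mH: "continuous_map (prod_topology T T) T (\<lambda>(a, b). a \<otimes>\<^bsub>H\<^esub> b)"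
    and iG: "continuous_map S S (\<lambda>a. inv\<^bsub>G\<^esub> a)" and iH: "continuous_map T T (\<lambda>a. inv\<^bsub>H\<^esub> a)"
    using assms by (auto simp: topological_group_def)
  show "group (G \<times>\<times> H)" by (rule DirProd_group[OF g])
  show "topspace (prod_topology S T) = carrier (G \<times>\<times> H)"
    by (simp add: c DirProd_def)
  let ?P = "prod_topology (prod_topology S T) (prod_topology S T)"
  have "continuous_map ?P (prod_topology S S) (\<lambda>p. (fst (fst p), fst (snd p)))"
    "continuous_map ?P (prod_topology T T) (\<lambda>p. (snd (fst p), snd (snd p)))"
    using continuous_map_compose[OF continuous_map_fst continuous_map_fst]
      continuous_map_compose[OF continuous_map_snd continuous_map_fst]
      continuous_map_compose[OF continuous_map_fst continuous_map_snd]
      continuous_map_compose[OF continuous_map_snd continuous_map_snd]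
    by (auto simp: o_def intro!: continuous_map_pairedI)
  from continuous_map_compose[OF this(1) mG] continuous_map_compose[OF this(2) mH]
  have "continuous_map ?P (prod_topology S T)
      (\<lambda>p. (fst (fst p) \<otimes>\<^bsub>G\<^esub> fst (snd p), snd (fst p) \<otimes>\<^bsub>H\<^esub> snd (snd p)))"
    by (intro continuous_map_pairedI) (simp_all add: o_def)
  then show "continuous_map ?P (prod_topology S T) (\<lambda>(a, b). a \<otimes>\<^bsub>G \<times>\<times> H\<^esub> b)"
    by (simp add: case_prod_unfold DirProd_def)
  have "continuous_map (prod_topology S T) (prod_topology S T) (\<lambda>p. (inv\<^bsub>G\<^esub> fst p, inv\<^bsub>H\<^esub> snd p))"
    using continuous_map_compose[OF continuous_map_fst iG] continuous_map_compose[OF continuous_map_snd iH]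
    by (intro continuous_map_pairedI) (simp_all add: o_def)
  then show "continuous_map (prod_topology S T) (prod_topology S T) (\<lambda>a. inv\<^bsub>G \<times>\<times> H\<^esub> a)"
    by (rule continuous_map_eq) (use g in \<open>auto simp: c inv_DirProd\<close>)
qed

lemma continuous_map_mat_diag:
  assumes "continuous_map X (mat_topology a l) f" "continuous_map X (mat_topology b q) g"
  shows "continuous_map X (mat_topology (a + b) (l + q)) (\<lambda>x. diag_block_mat [f x, g x])"
  unfolding continuous_map_mat_iff
proof (intro conjI allI impI)
  note car = continuous_map_mat_carrier[OF assms(1)] continuous_map_mat_carrier[OF assms(2)]
  show "(\<lambda>x. diag_block_mat [f x, g x]) \<in> topspace X \<rightarrow> carrier_mat (a + b) (l + q)"
    using car by (force intro!: carrier_matI)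
  fix i j assume ij: "i < a + b" "j < l + q"
  have "continuous_map X euclidean (\<lambda>x. if i < a then if j < l then f x $$ (i, j) else 0
      else if j < l then 0 else g x $$ (i - a, j - l))"
    using assms ij by (auto simp: continuous_map_mat_iff not_less)
  then show "continuous_map X euclidean (\<lambda>x. diag_block_mat [f x, g x] $$ (i, j))"
  proof (rule continuous_map_eq)
    fix x assume x: "x \<in> topspace X"
    then show "(if i < a then if j < l then f x $$ (i, j) else 0
      else if j < l then 0 else g x $$ (i - a, j - l)) = diag_block_mat [f x, g x] $$ (i, j)"
      using car[OF x] ij by (subst index_diag_pair) auto
  qed
qed

lemma block_translation_apply:
  "C \<in> stiefel k k \<Longrightarrow> block_translation k g C = diag_block_mat [fst g, snd g] * C"
  by (simp add: block_translation_def case_prod_unfold carrier_Sp)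

text \<open>
  The action is faithful because the identity matrix is moved to \<open>diag(a, b)\<close>.
\<close>
lemma block_translation_action:
  "faithful_action (Sp l \<times>\<times> Sp q) (stiefel (l + q) (l + q)) (block_translation (l + q))"
proof -
  let ?k = "l + q" and ?G = "Sp l \<times>\<times> Sp q"
  let ?D = "\<lambda>g :: quat mat \<times> quat mat. diag_block_mat [fst g, snd g]"
  have D: "?D g \<in> stiefel ?k ?k" if "g \<in> carrier ?G" for g
    using that by (auto simp: DirProd_def carrier_Sp intro: diag_pair_stiefel)
  have Bij: "block_translation ?k g \<in> Bij (stiefel ?k ?k)" if g: "g \<in> carrier ?G" for g
  proof -
    note dD = stiefelD[OF D[OF g]]
    have "bij_betw (block_translation ?k g) (stiefel ?k ?k) (stiefel ?k ?k)"
    proof (rule bij_betw_byWitness[where f' = "\<lambda>C. mat_adjoint (?D g) * C"])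
      show "\<forall>C\<in>stiefel ?k ?k. mat_adjoint (?D g) * block_translation ?k g C = C"
      proof
        fix C assume C: "C \<in> stiefel ?k ?k"
        have "mat_adjoint (?D g) * (?D g * C) = mat_adjoint (?D g) * ?D g * C"
          using dD(2,3) stiefelD(2)[OF C] by (simp add: mat_assoc del: dim_diag_pair)
        then show "mat_adjoint (?D g) * block_translation ?k g C = C"
          unfolding dD(4) using stiefelD(2)[OF C] by (simp add: block_translation_apply[OF C])
      qed
      show "\<forall>C\<in>stiefel ?k ?k. block_translation ?k g (mat_adjoint (?D g) * C) = C"
      proof
        fix C assume C: "C \<in> stiefel ?k ?k"
        have "?D g * (mat_adjoint (?D g) * C) = ?D g * mat_adjoint (?D g) * C"
          using dD(2,3) stiefelD(2)[OF C] by (simp add: mat_assoc del: dim_diag_pair)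
        then show "block_translation ?k g (mat_adjoint (?D g) * C) = C"
          unfolding Sp_mult_adjoint[OF D[OF g]] using stiefelD(2)[OF C]
          by (simp add: block_translation_apply stiefel_mult[OF stiefel_adjoint[OF D[OF g]] C])
      qed
    qed (auto simp: block_translation_apply intro!: stiefel_mult stiefel_adjoint D g)
    moreover have "block_translation ?k g \<in> extensional (stiefel ?k ?k)"
      by (simp add: block_translation_def case_prod_unfold carrier_Sp)
    ultimately show ?thesis by (simp add: Bij_def)
  qed
  have mult: "block_translation ?k (g \<otimes>\<^bsub>?G\<^esub> h) =
      compose (stiefel ?k ?k) (block_translation ?k g) (block_translation ?k h)"
    if g: "g \<in> carrier ?G" and h: "h \<in> carrier ?G" for g h
  proof
    fix C
    show "block_translation ?k (g \<otimes>\<^bsub>?G\<^esub> h) C =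
        compose (stiefel ?k ?k) (block_translation ?k g) (block_translation ?k h) C"
    proof (cases "C \<in> stiefel ?k ?k")
      case True
      have "?D (g \<otimes>\<^bsub>?G\<^esub> h) = ?D g * ?D h"
        using g h by (subst diag_pair_mult) (auto simp: DirProd_def Sp_def)
      moreover have "?D g * ?D h * C = ?D g * (?D h * C)"
        using stiefelD[OF D[OF g]] stiefelD[OF D[OF h]] stiefelD[OF True] by (intro mat_assoc) simp_all
      ultimately show ?thesis
        using True stiefel_mult[OF D[OF h] True] by (simp add: compose_def block_translation_apply)
    qed (simp add: compose_def block_translation_def case_prod_unfold carrier_Sp)
  qed
  have "group_hom ?G (BijGroup (stiefel ?k ?k)) (block_translation ?k)"
  proof (intro group_hom.intro group_hom_axioms.intro)
    show "group ?G" by (intro DirProd_group group_Sp)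
    show "group (BijGroup (stiefel ?k ?k))" by (rule group_BijGroup)
    show "block_translation ?k \<in> hom ?G (BijGroup (stiefel ?k ?k))"
      by (rule homI) (use Bij mult in \<open>auto simp: BijGroup_def\<close>)
  qed
  moreover have "inj_on (block_translation ?k) (carrier ?G)"
  proof (rule inj_onI)
    fix g h assume g: "g \<in> carrier ?G" and h: "h \<in> carrier ?G"
      and e: "block_translation ?k g = block_translation ?k h"
    have "?D g * 1\<^sub>m ?k = ?D h * 1\<^sub>m ?k"
      using arg_cong[OF e, of "\<lambda>f. f (1\<^sub>m ?k)"] by (simp add: block_translation_apply stiefel_one)
    then have "?D g = ?D h"
      using stiefelD(3)[OF D[OF g]] stiefelD(3)[OF D[OF h]] by (simp del: dim_diag_pair)
    then have "fst g = fst h \<and> snd g = snd h"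
      using g h by (intro diag_pair_inject) (auto simp: DirProd_def Sp_def)
    then show "g = h" by (simp add: prod_eq_iff)
  qed
  ultimately show ?thesis
    by (intro faithful_action.intro group_action.intro faithful_action_axioms.intro)
qed

lemma continuous_map_block_translation:
  "continuous_map (prod_topology (prod_topology (Sp_topology l) (Sp_topology q)) (Sp_topology (l + q)))
     (Sp_topology (l + q)) (\<lambda>(g, y). block_translation (l + q) g y)"
proof -
  let ?X = "prod_topology (prod_topology (Sp_topology l) (Sp_topology q)) (Sp_topology (l + q))"
  have id: "continuous_map (Sp_topology m) (mat_topology m m) (\<lambda>a. a)" for m
    by (simp add: Sp_topology_def continuous_map_from_subtopology)
  have 1: "continuous_map ?X (mat_topology l l) (\<lambda>p. fst (fst p))"
    using continuous_map_compose[OF continuous_map_compose[OF continuous_map_fst continuous_map_fst] id]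
    by (simp add: o_def)
  have 2: "continuous_map ?X (mat_topology q q) (\<lambda>p. snd (fst p))"
    using continuous_map_compose[OF continuous_map_compose[OF continuous_map_fst continuous_map_snd] id]
    by (simp add: o_def)
  have 3: "continuous_map ?X (mat_topology (l + q) (l + q)) snd"
    using continuous_map_compose[OF continuous_map_snd id] by (simp add: o_def)
  have "continuous_map ?X (mat_topology (l + q) (l + q)) (\<lambda>p. diag_block_mat [fst (fst p), snd (fst p)] * snd p)"
    by (rule continuous_map_mat_mult[OF continuous_map_mat_diag[OF 1 2] 3])
  then have "continuous_map ?X (Sp_topology (l + q)) (\<lambda>p. diag_block_mat [fst (fst p), snd (fst p)] * snd p)"
    by (auto simp: continuous_map_Sp_iff intro!: stiefel_mult diag_pair_stiefel)
  then show ?thesis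
    by (rule continuous_map_eq) (auto simp: block_translation_apply)
qed

section \<open>The bundle\<close>

definition level_projection :: "nat \<Rightarrow> nat \<Rightarrow> quat mat \<Rightarrow> quat vec set \<times> quat vec set" where
  "level_projection n k x = (column_space (upper_block n k x), column_space (lower_block n k x))"

definition level_chart ::
  "(quat vec set \<Rightarrow> quat mat) \<Rightarrow> (quat vec set \<Rightarrow> quat mat) \<Rightarrow> (quat vec set \<times> quat vec set) \<times> quat mat \<Rightarrow> quat mat" where
  "level_chart \<sigma> \<tau> = (\<lambda>(b, C). diag_block_mat [\<sigma> (fst b), \<tau> (snd b)] * C)"

lemma topspace_critical_level_topology:
  "topspace (critical_level_topology n k r) = critical_level n k r"
  using stiefelD(1)[OF critical_level_stiefel] by (auto simp: critical_level_topology_def)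

lemma continuous_map_upper_block:
  assumes "continuous_map X (mat_topology n k) f"
  shows "continuous_map X (mat_topology (n - k) k) (\<lambda>x. upper_block n k (f x))"
  using assms by (auto simp: continuous_map_mat_iff)

lemma continuous_map_lower_block:
  assumes "continuous_map X (mat_topology n k) f" "k \<le> n"
  shows "continuous_map X (mat_topology k k) (\<lambda>x. lower_block n k (f x))"
  using assms by (auto simp: continuous_map_mat_iff)

lemma continuous_map_level_projection:
  assumes k: "k \<le> n"
  shows "continuous_map (critical_level_topology n k (real q))
    (prod_topology (grassmannian_topology (n - k) (k - q)) (grassmannian_topology k q)) (level_projection n k)"
  unfolding level_projection_def
proof (intro continuous_map_pairedI continuous_map_grassmannianI)
  let ?E = "critical_level_topology n k (real q)"
  have id: "continuous_map ?E (mat_topology n k) (\<lambda>x. x)"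
    by (simp add: critical_level_topology_def continuous_map_from_subtopology)
  note u = continuous_map_upper_block[OF id] and l = continuous_map_lower_block[OF id k]
  show "column_space (upper_block n k x) \<in> grassmannian (n - k) (k - q)"
    "column_space (lower_block n k x) \<in> grassmannian k q" if "x \<in> topspace ?E" for x
    using that critical_level_column_spaces[OF _ k] by (auto simp: topspace_critical_level_topology)
  show "continuous_map ?E (mat_topology (n - k) (n - k)) (\<lambda>x. orth_proj (n - k) (column_space (upper_block n k x)))"
    by (rule continuous_map_eq[OF continuous_map_mat_mult[OF u continuous_map_mat_adjoint[OF u]]])
      (auto simp: topspace_critical_level_topology critical_level_blocks[OF _ k])
  show "continuous_map ?E (mat_topology k k) (\<lambda>x. orth_proj k (column_space (lower_block n k x)))"
    by (rule continuous_map_eq[OF continuous_map_mat_mult[OF l continuous_map_mat_adjoint[OF l]]])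
      (auto simp: topspace_critical_level_topology critical_level_blocks[OF _ k])
qed

lemma continuous_map_section_pair:
  assumes \<sigma>: "grassmannian_section a l U \<sigma>" and \<tau>: "grassmannian_section b q V \<tau>"
    and f: "continuous_map X (subtopology (prod_topology (grassmannian_topology a l) (grassmannian_topology b q)) (U \<times> V)) f"
  shows "continuous_map X (mat_topology a l) (\<lambda>x. \<sigma> (fst (f x)))"
    "continuous_map X (mat_topology b q) (\<lambda>x. \<tau> (snd (f x)))"
proof -
  note f = f[unfolded subtopology_Times]
  have "continuous_map (subtopology (grassmannian_topology a l) U) (mat_topology a l) \<sigma>"
    using \<sigma> by (simp add: grassmannian_section_def)
  from continuous_map_compose[OF continuous_map_compose[OF f continuous_map_fst] this]
  show "continuous_map X (mat_topology a l) (\<lambda>x. \<sigma> (fst (f x)))"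
    by (simp add: o_def)
  have "continuous_map (subtopology (grassmannian_topology b q) V) (mat_topology b q) \<tau>"
    using \<tau> by (simp add: grassmannian_section_def)
  from continuous_map_compose[OF continuous_map_compose[OF f continuous_map_snd] this]
  show "continuous_map X (mat_topology b q) (\<lambda>x. \<tau> (snd (f x)))"
    by (simp add: o_def)
qed

text \<open>
  The inverse of the chart \<open>(b, C) \<mapsto> D(b) C\<close>, where \<open>D(b)\<close> is the block diagonal matrix of the two
  sections at \<open>b\<close>, is \<open>x \<mapsto> (p x, D(p x)\<^sup>* x)\<close>.
\<close>
lemma homeomorphic_map_level_chart:
  assumes le: "q \<le> k" "k \<le> n"
    and \<sigma>: "grassmannian_section (n - k) (k - q) U \<sigma>" and \<tau>: "grassmannian_section k q V \<tau>"
  defines "B \<equiv> prod_topology (grassmannian_topology (n - k) (k - q)) (grassmannian_topology k q)"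
    and "E \<equiv> critical_level_topology n k (real q)"
  shows "homeomorphic_map (prod_topology (subtopology B (U \<times> V)) (Sp_topology k))
     (subtopology E {e \<in> topspace E. level_projection n k e \<in> U \<times> V}) (level_chart \<sigma> \<tau>)"
    and "\<forall>b\<in>U \<times> V. \<forall>C\<in>topspace (Sp_topology k). level_projection n k (level_chart \<sigma> \<tau> (b, C)) = b"
proof -
  let ?X = "prod_topology (subtopology B (U \<times> V)) (Sp_topology k)"
  let ?W = "{e \<in> topspace E. level_projection n k e \<in> U \<times> V}"
  let ?Y = "subtopology E ?W"
  let ?D = "\<lambda>b. diag_block_mat [\<sigma> (fst b), \<tau> (snd b)]"
  have s: "\<sigma> S \<in> stiefel (n - k) (k - q)" "column_space (\<sigma> S) = S" if "S \<in> U" for S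
    using \<sigma> that by (auto simp: grassmannian_section_def)
  have t: "\<tau> S \<in> stiefel k q" "column_space (\<tau> S) = S" if "S \<in> V" for S
    using \<tau> that by (auto simp: grassmannian_section_def)
  have kq: "(k - q) + q = k" and nk: "(n - k) + k = n" using le by auto
  have chart: "level_chart \<sigma> \<tau> (b, C) \<in> critical_level n k (real q)"
      "level_projection n k (level_chart \<sigma> \<tau> (b, C)) = b"
    if "b \<in> U \<times> V" "C \<in> stiefel k k" for b C
  proof -
    have b: "fst b \<in> U" "snd b \<in> V" using that(1) by auto
    note * = diag_frames_mult_in_critical_level[OF s(1)[OF b(1)] t(1)[OF b(2)] that(2) le]
    show "level_chart \<sigma> \<tau> (b, C) \<in> critical_level n k (real q)"
      using *(1) by (simp add: level_chart_def)
    show "level_projection n k (level_chart \<sigma> \<tau> (b, C)) = b"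
      using *(2,3) b by (simp add: level_chart_def level_projection_def s(2) t(2))
  qed
  then show "\<forall>b\<in>U \<times> V. \<forall>C\<in>topspace (Sp_topology k). level_projection n k (level_chart \<sigma> \<tau> (b, C)) = b"
    by auto
  have topX: "topspace ?X \<subseteq> (U \<times> V) \<times> stiefel k k"
    by auto
  have topY: "topspace ?Y = ?W"
    by auto
  have inv: "?D (level_projection n k x) * (mat_adjoint (?D (level_projection n k x)) * x) = x"
      "mat_adjoint (?D (level_projection n k x)) * x \<in> stiefel k k" if "x \<in> ?W" for x
  proof -
    have x: "x \<in> critical_level n k (real q)" "column_space (upper_block n k x) \<in> U"
      "column_space (lower_block n k x) \<in> V"
      using that by (auto simp: E_def topspace_critical_level_topology level_projection_def)
    show "?D (level_projection n k x) * (mat_adjoint (?D (level_projection n k x)) * x) = x"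
      "mat_adjoint (?D (level_projection n k x)) * x \<in> stiefel k k"
      using critical_level_factor[OF x(1) le(2) s[OF x(2)] t[OF x(3)]] by (simp_all add: level_projection_def)
  qed
  have "continuous_map ?X ?Y (level_chart \<sigma> \<tau>)"
  proof -
    have f: "continuous_map ?X (subtopology B (U \<times> V)) fst" by (rule continuous_map_fst)
    have c: "continuous_map ?X (mat_topology k k) snd"
      using continuous_map_snd[of "subtopology B (U \<times> V)" "Sp_topology k"] by (simp add: continuous_map_Sp_iff)
    have "continuous_map ?X (mat_topology n k) (\<lambda>p. ?D (fst p) * snd p)"
      using continuous_map_mat_mult[OF continuous_map_mat_diag[OF continuous_map_section_pair[OF \<sigma> \<tau> f[unfolded B_def]]], of k snd] c
      unfolding kq nk B_def by simp
    then have "continuous_map ?X (mat_topology n k) (level_chart \<sigma> \<tau>)"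
      by (simp add: level_chart_def case_prod_unfold)
    moreover have "level_chart \<sigma> \<tau> p \<in> critical_level n k (real q) \<and>
        level_projection n k (level_chart \<sigma> \<tau> p) \<in> U \<times> V" if "p \<in> topspace ?X" for p
      using chart[of "fst p" "snd p"] subsetD[OF topX that] by auto
    ultimately show ?thesis
      by (auto simp: continuous_map_in_subtopology E_def critical_level_topology_def
          topspace_critical_level_topology[unfolded critical_level_topology_def] simp del: topspace_subtopology)
  qed
  moreover have "continuous_map ?Y ?X (\<lambda>x. (level_projection n k x, mat_adjoint (?D (level_projection n k x)) * x))"
  proof (rule continuous_map_pairedI)
    have "continuous_map ?Y B (level_projection n k)"
      unfolding E_def B_def by (rule continuous_map_from_subtopology[OF continuous_map_level_projection[OF le(2)]])
    then show f: "continuous_map ?Y (subtopology B (U \<times> V)) (level_projection n k)"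
      by (auto simp: continuous_map_in_subtopology)
    have id: "continuous_map ?Y (mat_topology n k) (\<lambda>x. x)"
      by (simp add: E_def critical_level_topology_def continuous_map_from_subtopology)
    have "continuous_map ?Y (mat_topology n k) (\<lambda>x. ?D (level_projection n k x))"
      using continuous_map_mat_diag[OF continuous_map_section_pair[OF \<sigma> \<tau> f[unfolded B_def]]]
      unfolding kq nk B_def by simp
    from continuous_map_mat_mult[OF continuous_map_mat_adjoint[OF this] id]
    show "continuous_map ?Y (Sp_topology k) (\<lambda>x. mat_adjoint (?D (level_projection n k x)) * x)"
      unfolding continuous_map_Sp_iff using inv(2) topY by blast
  qed
  moreover have "(level_projection n k (level_chart \<sigma> \<tau> p),
      mat_adjoint (?D (level_projection n k (level_chart \<sigma> \<tau> p))) * level_chart \<sigma> \<tau> p) = p"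
    if "p \<in> topspace ?X" for p
  proof -
    obtain b C where p: "p = (b, C)" by (cases p)
    have b: "b \<in> U \<times> V" "C \<in> stiefel k k" using subsetD[OF topX that] by (auto simp: p)
    then have "mat_adjoint (?D b) * (?D b * C) = C"
      using stiefelD(1)[OF b(2)] by (intro adjoint_diag_mult_cancel[OF s(1) t(1)]) (auto simp: kq)
    then show ?thesis
      using chart(2)[OF b] by (simp add: p level_chart_def)
  qed
  moreover have "level_chart \<sigma> \<tau> (level_projection n k x, mat_adjoint (?D (level_projection n k x)) * x) = x"
    if "x \<in> topspace ?Y" for x
    using inv(1)[of x] that topY by (simp add: level_chart_def)
  ultimately show "homeomorphic_map ?X ?Y (level_chart \<sigma> \<tau>)"
    unfolding homeomorphic_map_maps homeomorphic_maps_def by blast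
qed

text \<open>
  Both frames give the same projection \<open>Y Y\<^sup>*\<close>, which fixes \<open>Y'\<close>.
\<close>
lemma frame_change:
  assumes Y: "Y \<in> stiefel m l" and Y': "Y' \<in> stiefel m l" and eq: "column_space Y = column_space Y'"
  shows "mat_adjoint Y * Y' \<in> stiefel l l" "Y * (mat_adjoint Y * Y') = Y'"
proof -
  note d = stiefelD[OF Y] and d' = stiefelD[OF Y']
  have "Y * mat_adjoint Y = Y' * mat_adjoint Y'"
    using orth_proj_frame[OF Y] orth_proj_frame[OF Y'] by (simp add: eq)
  then have "Y * mat_adjoint Y * Y' = Y'"
    using d'(2,3,5) by (simp add: mat_assoc)
  then show e: "Y * (mat_adjoint Y * Y') = Y'"
    using d(2,3) d'(2,3) by (simp add: mat_assoc)
  have "mat_adjoint (mat_adjoint Y * Y') * (mat_adjoint Y * Y') = mat_adjoint Y' * (Y * (mat_adjoint Y * Y'))"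
    using d(2,3) d'(2,3) by (simp add: mat_adjoint_mult mat_assoc)
  then show "mat_adjoint Y * Y' \<in> stiefel l l"
    using e d(2,3) d'(2-4) by (auto simp: stiefel_def intro!: carrier_matI)
qed

text \<open>
  Over the intersection of the domains the two pairs of sections differ by \<open>\<sigma>\<^sup>* \<sigma>'\<close> and \<open>\<tau>\<^sup>* \<tau>'\<close>, which
  are unitary by \<open>frame_change\<close>.
\<close>
lemma level_chart_transition:
  assumes le: "q \<le> k" "k \<le> n"
    and \<sigma>: "grassmannian_section (n - k) (k - q) U \<sigma>" and \<tau>: "grassmannian_section k q V \<tau>"
    and \<sigma>': "grassmannian_section (n - k) (k - q) U' \<sigma>'" and \<tau>': "grassmannian_section k q V' \<tau>'"
  shows "\<exists>g. continuous_map
      (subtopology (prod_topology (grassmannian_topology (n - k) (k - q)) (grassmannian_topology k q))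
        (U \<times> V \<inter> U' \<times> V'))
      (prod_topology (Sp_topology (k - q)) (Sp_topology q)) g \<and>
    (\<forall>b\<in>U \<times> V \<inter> U' \<times> V'. \<forall>C\<in>topspace (Sp_topology k).
       level_chart \<sigma>' \<tau>' (b, C) = level_chart \<sigma> \<tau> (b, block_translation k (g b) C))"
proof -
  let ?B = "prod_topology (grassmannian_topology (n - k) (k - q)) (grassmannian_topology k q)"
  let ?X = "subtopology ?B (U \<times> V \<inter> U' \<times> V')"
  define g where "g b = (mat_adjoint (\<sigma> (fst b)) * \<sigma>' (fst b), mat_adjoint (\<tau> (snd b)) * \<tau>' (snd b))" for b
  have kq: "(k - q) + q = k" using le by simp
  have fr: "mat_adjoint (\<sigma> (fst b)) * \<sigma>' (fst b) \<in> stiefel (k - q) (k - q)"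
      "\<sigma> (fst b) * (mat_adjoint (\<sigma> (fst b)) * \<sigma>' (fst b)) = \<sigma>' (fst b)"
      "mat_adjoint (\<tau> (snd b)) * \<tau>' (snd b) \<in> stiefel q q"
      "\<tau> (snd b) * (mat_adjoint (\<tau> (snd b)) * \<tau>' (snd b)) = \<tau>' (snd b)"
      "\<sigma> (fst b) \<in> stiefel (n - k) (k - q)" "\<tau> (snd b) \<in> stiefel k q"
    if "b \<in> U \<times> V \<inter> U' \<times> V'" for b
    using that frame_change[of "\<sigma> (fst b)" "n - k" "k - q" "\<sigma>' (fst b)"]
      frame_change[of "\<tau> (snd b)" k q "\<tau>' (snd b)"]
      \<sigma> \<tau> \<sigma>' \<tau>' by (auto simp: grassmannian_section_def)
  have sub: "continuous_map ?X (subtopology ?B (U \<times> V)) (\<lambda>b. b)" "continuous_map ?X (subtopology ?B (U' \<times> V')) (\<lambda>b. b)"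
    by (auto simp: continuous_map_in_subtopology continuous_map_from_subtopology)
  note c = continuous_map_section_pair[OF \<sigma> \<tau> sub(1)] and c' = continuous_map_section_pair[OF \<sigma>' \<tau>' sub(2)]
  have "continuous_map ?X (prod_topology (Sp_topology (k - q)) (Sp_topology q)) g"
    unfolding g_def
  proof (rule continuous_map_pairedI)
    have top: "topspace ?X \<subseteq> U \<times> V \<inter> U' \<times> V'" by auto
    show "continuous_map ?X (Sp_topology (k - q)) (\<lambda>b. mat_adjoint (\<sigma> (fst b)) * \<sigma>' (fst b))"
      unfolding continuous_map_Sp_iff
      using continuous_map_mat_mult[OF continuous_map_mat_adjoint[OF c(1)] c'(1)] fr(1) subsetD[OF top] by blast
    show "continuous_map ?X (Sp_topology q) (\<lambda>b. mat_adjoint (\<tau> (snd b)) * \<tau>' (snd b))"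
      unfolding continuous_map_Sp_iff
      using continuous_map_mat_mult[OF continuous_map_mat_adjoint[OF c(2)] c'(2)] fr(3) subsetD[OF top] by blast
  qed
  moreover have "level_chart \<sigma>' \<tau>' (b, C) = level_chart \<sigma> \<tau> (b, block_translation k (g b) C)"
    if b: "b \<in> U \<times> V \<inter> U' \<times> V'" and C: "C \<in> stiefel k k" for b C
  proof -
    note fr = fr[OF b]
    let ?D = "diag_block_mat [\<sigma> (fst b), \<tau> (snd b)]" and ?G = "diag_block_mat [fst (g b), snd (g b)]"
    have G: "?G \<in> stiefel k k"
      using diag_pair_stiefel[OF fr(1) fr(3)] by (simp add: g_def kq)
    have DG: "?D * ?G = diag_block_mat [\<sigma>' (fst b), \<tau>' (snd b)]"
      using fr stiefelD(3)[OF fr(5)] stiefelD(3)[OF fr(6)]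
      by (subst diag_pair_mult) (auto simp: g_def)
    have "?D * (?G * C) = ?D * ?G * C"
      using stiefelD(2,3)[OF G] stiefelD(2)[OF C] stiefelD(3)[OF fr(5)] stiefelD(3)[OF fr(6)] kq
      by (intro mat_assoc[symmetric]) simp_all
    then show ?thesis
      by (simp add: level_chart_def DG block_translation_apply[OF C])
  qed
  ultimately show ?thesis
    by (intro exI[of _ g]) auto
qed

theorem proposition4p3:
  fixes n k q :: nat
  assumes "0 \<le> k" and "k < n"
    and "real q \<in> critical_values n k (height n k)"
  shows "\<exists>p. fibre_bundle
           (critical_level_topology n k (real q))
           (prod_topology (grassmannian_topology (n - k) (k - q)) (grassmannian_topology k q))
           p
           (Sp_topology k)
           (Sp (k - q) \<times>\<times> Sp q)
           (prod_topology (Sp_topology (k - q)) (Sp_topology q))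
           (block_translation k)"
proof
  have kn: "k \<le> n" using assms(2) by simp
  \<comment> \<open>The fibre is \<open>Sp(k)\<close> with \<open>k = (k - q) + q\<close>; that \<open>q\<close> is at most \<open>k\<close> follows from the existence of a critical point.\<close>
  obtain x where "x \<in> critical_level n k (real q)"
    using assms(3) by (auto simp: critical_values_def critical_level_def)
  then have qk: "q \<le> k"
    using critical_level_le kn by blast
  then have kq: "(k - q) + q = k" by simp
  let ?E = "critical_level_topology n k (real q)"
  let ?B = "prod_topology (grassmannian_topology (n - k) (k - q)) (grassmannian_topology k q)"
  define \<A> where "\<A> = {(U \<times> V, level_chart \<sigma> \<tau>) | U V \<sigma> \<tau>.
      grassmannian_section (n - k) (k - q) U \<sigma> \<and> grassmannian_section k q V \<tau>}"
  have open_sec: "openin (grassmannian_topology m l) U" if "grassmannian_section m l U \<sigma>" for m l U \<sigma>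
    using that by (simp add: grassmannian_section_def)
  have "\<Union>(fst ` \<A>) = topspace ?B"
  proof
    show "\<Union>(fst ` \<A>) \<subseteq> topspace ?B"
      using openin_subset[OF open_sec] by (fastforce simp: \<A>_def)
    show "topspace ?B \<subseteq> \<Union>(fst ` \<A>)"
    proof
      fix b assume "b \<in> topspace ?B"
      then have "fst b \<in> grassmannian (n - k) (k - q)" "snd b \<in> grassmannian k q" by auto
      then obtain U V \<sigma> \<tau> where "grassmannian_section (n - k) (k - q) U \<sigma>" "fst b \<in> U"
        "grassmannian_section k q V \<tau>" "snd b \<in> V"
        using ex_grassmannian_section by blast
      then have "(U \<times> V, level_chart \<sigma> \<tau>) \<in> \<A>" "b \<in> U \<times> V"
        by (auto simp: \<A>_def mem_Times_iff)
      then show "b \<in> \<Union>(fst ` \<A>)"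
        by (metis UN_I fst_conv)
    qed
  qed
  moreover have "\<forall>(U, \<phi>) \<in> \<A>. openin ?B U \<and>
      homeomorphic_map (prod_topology (subtopology ?B U) (Sp_topology k))
        (subtopology ?E {e \<in> topspace ?E. level_projection n k e \<in> U}) \<phi> \<and>
      (\<forall>b\<in>U. \<forall>y\<in>topspace (Sp_topology k). level_projection n k (\<phi> (b, y)) = b)"
  proof clarify
    fix W \<phi> assume "(W, \<phi>) \<in> \<A>"
    then obtain U V \<sigma> \<tau> where
      sec: "grassmannian_section (n - k) (k - q) U \<sigma>" "grassmannian_section k q V \<tau>"
      and eq: "W = U \<times> V" "\<phi> = level_chart \<sigma> \<tau>"
      unfolding \<A>_def by blast
    show "openin ?B W \<and>
      homeomorphic_map (prod_topology (subtopology ?B W) (Sp_topology k))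
        (subtopology ?E {e \<in> topspace ?E. level_projection n k e \<in> W}) \<phi> \<and>
      (\<forall>b\<in>W. \<forall>y\<in>topspace (Sp_topology k). level_projection n k (\<phi> (b, y)) = b)"
      unfolding eq using homeomorphic_map_level_chart[OF qk kn sec] open_sec[OF sec(1)] open_sec[OF sec(2)]
      by (simp only: openin_prod_Times_iff simp_thms)
  qed
  moreover have "\<forall>(U, \<phi>) \<in> \<A>. \<forall>(V, \<psi>) \<in> \<A>.
      \<exists>g. continuous_map (subtopology ?B (U \<inter> V)) (prod_topology (Sp_topology (k - q)) (Sp_topology q)) g \<and>
        (\<forall>b \<in> U \<inter> V. \<forall>y\<in>topspace (Sp_topology k). \<psi> (b, y) = \<phi> (b, block_translation k (g b) y))"
  proof clarify
    fix W \<phi> W' \<psi> assume "(W, \<phi>) \<in> \<A>" "(W', \<psi>) \<in> \<A>"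
    then obtain U V \<sigma> \<tau> U' V' \<sigma>' \<tau>' where
      "grassmannian_section (n - k) (k - q) U \<sigma>" "grassmannian_section k q V \<tau>"
      "grassmannian_section (n - k) (k - q) U' \<sigma>'" "grassmannian_section k q V' \<tau>'"
      and eq: "W = U \<times> V" "\<phi> = level_chart \<sigma> \<tau>" "W' = U' \<times> V'" "\<psi> = level_chart \<sigma>' \<tau>'"
      unfolding \<A>_def by blast
    then show "\<exists>g. continuous_map (subtopology ?B (W \<inter> W')) (prod_topology (Sp_topology (k - q)) (Sp_topology q)) g \<and>
        (\<forall>b \<in> W \<inter> W'. \<forall>y\<in>topspace (Sp_topology k). \<psi> (b, y) = \<phi> (b, block_translation k (g b) y))"
      unfolding eq by (intro level_chart_transition[OF qk kn])
  qed
  ultimately have "\<exists>\<A> :: ((quat vec set \<times> quat vec set) set \<times> ((quat vec set \<times> quat vec set) \<times> quat mat \<Rightarrow> quat mat)) set.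
      \<Union>(fst ` \<A>) = topspace ?B \<and>
      (\<forall>(U, \<phi>) \<in> \<A>. openin ?B U \<and>
        homeomorphic_map (prod_topology (subtopology ?B U) (Sp_topology k))
          (subtopology ?E {e \<in> topspace ?E. level_projection n k e \<in> U}) \<phi> \<and>
        (\<forall>b\<in>U. \<forall>y\<in>topspace (Sp_topology k). level_projection n k (\<phi> (b, y)) = b)) \<and>
      (\<forall>(U, \<phi>) \<in> \<A>. \<forall>(V, \<psi>) \<in> \<A>.
        \<exists>g. continuous_map (subtopology ?B (U \<inter> V)) (prod_topology (Sp_topology (k - q)) (Sp_topology q)) g \<and>
          (\<forall>b \<in> U \<inter> V. \<forall>y\<in>topspace (Sp_topology k). \<psi> (b, y) = \<phi> (b, block_translation k (g b) y)))"
    by blast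
  then show "fibre_bundle ?E ?B (level_projection n k) (Sp_topology k) (Sp (k - q) \<times>\<times> Sp q)
      (prod_topology (Sp_topology (k - q)) (Sp_topology q)) (block_translation k)"
    unfolding fibre_bundle_def
    using topological_group_DirProd[OF topological_group_Sp[of "k - q"] topological_group_Sp[of q]]
      block_translation_action[of "k - q" q] continuous_map_block_translation[of "k - q" q]
      continuous_map_level_projection[OF kn, of q]
    unfolding kq topspace_Sp_topology by blast
qed

end
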